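(* Let $W=W_{A_{n-1}}$ and let $V$ be a $\mathbb CW^-$-module. The action of $\xi_i$ on the $\ddot{\mathfrak H}^-_W$-module $\mathbb C[y_1,\dots,y_n]\otimes V$ is realized as a Dunkl operator as follows. For any polynomial $f\in\mathbb C[y_1,\dots,y_n]$ and $v\in V$, $$\xi_i\circ(f\otimes v)=u\sum_{k\ne i}\frac{f-f^{s_{ki}}}{y_i-y_k}\otimes[k,i]\,v .$$
   Context: Ground field $\mathbb C$, $u\in\mathbb C$. $W=W_{A_{n-1}}=S_n$; $s_{ij}$ is the transposition of $i,j$, and $f^\sigma$ denotes the permutation action of $\sigma\in S_n$ on $f\in\mathbb C[y_1,\dots,y_n]$. The spin group algebra $\mathbb CW^-$ of type $A_{n-1}$ is generated by $t_1,\dots,t_{n-1}$ with $t_i^2=1$, $t_it_{i+1}t_i=t_{i+1}t_it_{i+1}$, $(t_it_j)^2=-1$ if $|i-j|>1$. For $1\le i<j\le n$ put $[i,j]=(-1)^{j-i-1}t_{j-1}\cdots t_{i+1}t_it_{i+1}\cdots t_{j-1}$ and $[j,i]=-[i,j]$. The rational spin double affine Hecke algebra $\ddot{\mathfrak H}^-_W$ of type $A_{n-1}$ is generated by $\xi_i,y_i$ ($1\le i\le n$) and $\mathbb CW^-$, subject to: $y_iy_j=y_jy_i$; $\xi_i\xi_j=-\xi_j\xi_i$ ($i\ne j$); $t_iy_i=y_{i+1}t_i$, $t_i\xi_i=-\xi_{i+1}t_i$; $t_iy_j=y_jt_i$, $t_i\xi_j=-\xi_jt_i$ ($j\ne i,i+1$);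 $y_j\xi_i-\xi_iy_j=-u[i,j]$ ($i\ne j$); $y_i\xi_i-\xi_iy_i=u\sum_{k\ne i}[i,k]$. It has the triangular decomposition $\mathcal C[\xi_1,\dots,\xi_n]\otimes\mathbb CW^-\otimes\mathbb C[y_1,\dots,y_n]$, where $\mathcal C[\xi_1,\dots,\xi_n]$ is the skew-polynomial algebra with $\xi_i\xi_j=-\xi_j\xi_i$ ($i\ne j$). Let $\mathfrak h_\xi$ be the subalgebra generated by the $\xi_i$ and $\mathbb CW^-$. A $\mathbb CW^-$-module $V$ is extended to an $\mathfrak h_\xi$-module by letting all $\xi_i$ act by $0$, and $V_\xi=\mathrm{Ind}_{\mathfrak h_\xi}^{\ddot{\mathfrak H}^-_W}V$ is identified with $\mathbb C[y_1,\dots,y_n]\otimes V$; this is the module structure in question ($t_i$ acts as $s_i\otimes t_i$, where $s_i=s_{i,i+1}$; $y_i$ acts by left multiplication; $\circ$ denotes the action). *)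

theory Defs
  imports
    Complex_Main
    "HOL-Library.Poly_Mapping"
    "HOL-Algebra.QuotRing"
    "HOL-Algebra.Generated_Rings"
    "HOL-Algebra.Free_Abelian_Groups"
    "HOL-Combinatorics.Transposition"
begin

section \<open>Algebras presented by generators and relations\<close>

text \<open>
  The free monoid, written additively so that finitely supported functions
  on it form, with the convolution product of \<^theory>\<open>HOL-Library.Poly_Mapping\<close>,
  the free associative unital complex algebra.
\<close>

datatype 'a fmon = FMon (letters: "'a list")

instantiation fmon :: (type) monoid_add
begin

definition zero_fmon :: "'a fmon" where
  "0 = FMon []"

definition plus_fmon :: "'a fmon \<Rightarrow> 'a fmon \<Rightarrow> 'a fmon" where
  "a + b = FMon (letters a @ letters b)"

instance
  by standard (simp_all add: zero_fmon_def plus_fmon_def)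

end

type_synonym 'a falg = "'a fmon \<Rightarrow>\<^sub>0 complex"

definition gen :: "'g \<Rightarrow> 'g falg" where
  "gen g = Poly_Mapping.single (FMon [g]) 1"

definition const :: "complex \<Rightarrow> 'g falg" where
  "const c = Poly_Mapping.single 0 c"

definition free_alg :: "'g set \<Rightarrow> 'g falg ring" where
  "free_alg G = \<lparr>carrier = {p. \<forall>w\<in>Poly_Mapping.keys p. set (letters w) \<subseteq> G},
     mult = (*), one = 1, ring.zero = 0, add = (+)\<rparr>"

definition presented_alg :: "'g set \<Rightarrow> 'g falg set \<Rightarrow> 'g falg set ring" where
  "presented_alg G R = free_alg G Quot (Idl\<^bsub>free_alg G\<^esub> R)"

definition presented_cls :: "'g set \<Rightarrow> 'g falg set \<Rightarrow> 'g falg \<Rightarrow> 'g falg set" where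
  "presented_cls G R p = (Idl\<^bsub>free_alg G\<^esub> R) +>\<^bsub>free_alg G\<^esub> p"


section \<open>The spin group algebra and the rational spin double affine Hecke algebra\<close>

datatype spin_gen = GenT nat | GenXi nat | GenY nat

abbreviation t_gen :: "nat \<Rightarrow> spin_gen falg" where "t_gen i \<equiv> gen (GenT i)"
abbreviation xi_gen :: "nat \<Rightarrow> spin_gen falg" where "xi_gen i \<equiv> gen (GenXi i)"
abbreviation y_gen :: "nat \<Rightarrow> spin_gen falg" where "y_gen i \<equiv> gen (GenY i)"

text \<open>\<open>br i j\<close> is the element \<open>[i,j]\<close>; only \<open>i \<noteq> j\<close> is meaningful.\<close>

definition br_less :: "nat \<Rightarrow> nat \<Rightarrow> spin_gen falg" where
  "br_less i j = (-1) ^ (j - i - 1) *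
     (prod_list (map t_gen (rev [i+1..<j])) * t_gen i * prod_list (map t_gen [i+1..<j]))"

definition br :: "nat \<Rightarrow> nat \<Rightarrow> spin_gen falg" where
  "br i j = (if i < j then br_less i j else - br_less j i)"

definition spin_gens :: "nat \<Rightarrow> spin_gen set" where
  "spin_gens n = GenT ` {1..<n}"

definition spin_rels :: "nat \<Rightarrow> spin_gen falg set" where
  "spin_rels n =
     {t_gen i * t_gen i - 1 | i. i \<in> {1..<n}} \<union>
     {t_gen i * t_gen (i+1) * t_gen i - t_gen (i+1) * t_gen i * t_gen (i+1) | i. i \<in> {1..<n} \<and> i + 1 \<in> {1..<n}} \<union>
     {(t_gen i * t_gen j) ^ 2 + 1 | i j. i \<in> {1..<n} \<and> j \<in> {1..<n} \<and> (i + 1 < j \<or> j + 1 < i)}"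

definition daha_gens :: "nat \<Rightarrow> spin_gen set" where
  "daha_gens n = spin_gens n \<union> GenXi ` {1..n} \<union> GenY ` {1..n}"

definition daha_rels :: "nat \<Rightarrow> complex \<Rightarrow> spin_gen falg set" where
  "daha_rels n u =
     spin_rels n \<union>
     {y_gen i * y_gen j - y_gen j * y_gen i | i j. i \<in> {1..n} \<and> j \<in> {1..n}} \<union>
     {xi_gen i * xi_gen j + xi_gen j * xi_gen i | i j. i \<in> {1..n} \<and> j \<in> {1..n} \<and> i \<noteq> j} \<union>
     {t_gen i * y_gen i - y_gen (i+1) * t_gen i | i. i \<in> {1..<n}} \<union>
     {t_gen i * xi_gen i + xi_gen (i+1) * t_gen i | i. i \<in> {1..<n}} \<union>
     {t_gen i * y_gen j - y_gen j * t_gen i | i j. i \<in> {1..<n} \<and> j \<in> {1..n} \<and> j \<noteq> i \<and> j \<noteq> i + 1} \<union>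
     {t_gen i * xi_gen j + xi_gen j * t_gen i | i j. i \<in> {1..<n} \<and> j \<in> {1..n} \<and> j \<noteq> i \<and> j \<noteq> i + 1} \<union>
     {y_gen j * xi_gen i - xi_gen i * y_gen j + const u * br i j | i j. i \<in> {1..n} \<and> j \<in> {1..n} \<and> i \<noteq> j} \<union>
     {y_gen i * xi_gen i - xi_gen i * y_gen i - const u * (\<Sum>k\<in>{1..n} - {i}. br i k) | i. i \<in> {1..n}}"

abbreviation spin_alg :: "nat \<Rightarrow> spin_gen falg set ring" where
  "spin_alg n \<equiv> presented_alg (spin_gens n) (spin_rels n)"

abbreviation spin_cls :: "nat \<Rightarrow> spin_gen falg \<Rightarrow> spin_gen falg set" where
  "spin_cls n \<equiv> presented_cls (spin_gens n) (spin_rels n)"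

abbreviation daha :: "nat \<Rightarrow> complex \<Rightarrow> spin_gen falg set ring" where
  "daha n u \<equiv> presented_alg (daha_gens n) (daha_rels n u)"

abbreviation daha_cls :: "nat \<Rightarrow> complex \<Rightarrow> spin_gen falg \<Rightarrow> spin_gen falg set" where
  "daha_cls n u \<equiv> presented_cls (daha_gens n) (daha_rels n u)"


section \<open>Modules, balanced tensor products and the induced module\<close>

text \<open>
  Left modules over a not necessarily commutative ring; the underlying abelian
  group is a type. When the ring is a complex algebra, the vector space structure
  of the module is given by the action of the scalars.
\<close>

locale left_module = ring R for R (structure) +
  fixes act :: "'a \<Rightarrow> 'v::ab_group_add \<Rightarrow> 'v"
  assumes act_add_right: "a \<in> carrier R \<Longrightarrow> act a (v + w) = act a v + act a w"
    and act_add_left: "a \<in> carrier R \<Longrightarrow> b \<in> carrier R \<Longrightarrow> act (a \<oplus> b) v = act a v + act b v"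
    and act_mult: "a \<in> carrier R \<Longrightarrow> b \<in> carrier R \<Longrightarrow> act (a \<otimes> b) v = act a (act b v)"
    and act_one: "act \<one> v = v"

text \<open>
  For a ring \<open>A\<close>, a subring \<open>S\<close> and a left \<open>S\<close>-module \<open>V\<close>, the tensor product of \<open>A\<close>
  and \<open>V\<close> over \<open>S\<close> is the free abelian group on \<open>A \<times> V\<close> modulo the subgroup generated
  by the biadditivity and balancing relations.
\<close>

definition tensor_free :: "('a, 'm) ring_scheme \<Rightarrow> (('a \<times> 'v) \<Rightarrow>\<^sub>0 int) monoid" where
  "tensor_free A = free_Abelian_group (carrier A \<times> UNIV)"

definition tensor_rels ::
    "('a, 'm) ring_scheme \<Rightarrow> 'a set \<Rightarrow> ('a \<Rightarrow> 'v \<Rightarrow> 'v) \<Rightarrow> (('a \<times> 'v::ab_group_add) \<Rightarrow>\<^sub>0 int) set" where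
  "tensor_rels A S act =
     {frag_of (a \<oplus>\<^bsub>A\<^esub> b, v) - frag_of (a, v) - frag_of (b, v) | a b v.
        a \<in> carrier A \<and> b \<in> carrier A} \<union>
     {frag_of (a, v + w) - frag_of (a, v) - frag_of (a, w) | a v w. a \<in> carrier A} \<union>
     {frag_of (a \<otimes>\<^bsub>A\<^esub> s, v) - frag_of (a, act s v) | a s v. a \<in> carrier A \<and> s \<in> S}"

definition tensor_null ::
    "('a, 'm) ring_scheme \<Rightarrow> 'a set \<Rightarrow> ('a \<Rightarrow> 'v \<Rightarrow> 'v) \<Rightarrow> (('a \<times> 'v::ab_group_add) \<Rightarrow>\<^sub>0 int) set" where
  "tensor_null A S act = generate (tensor_free A) (tensor_rels A S act)"

definition tensor ::
    "('a, 'm) ring_scheme \<Rightarrow> 'a set \<Rightarrow> ('a \<Rightarrow> 'v \<Rightarrow> 'v) \<Rightarrow> (('a \<times> 'v::ab_group_add) \<Rightarrow>\<^sub>0 int) set monoid" where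
  "tensor A S act = tensor_free A Mod tensor_null A S act"

definition tensor_cls ::
    "('a, 'm) ring_scheme \<Rightarrow> 'a set \<Rightarrow> ('a \<Rightarrow> 'v \<Rightarrow> 'v) \<Rightarrow>
      (('a \<times> 'v::ab_group_add) \<Rightarrow>\<^sub>0 int) \<Rightarrow> (('a \<times> 'v) \<Rightarrow>\<^sub>0 int) set" where
  "tensor_cls A S act x = tensor_null A S act #>\<^bsub>tensor_free A\<^esub> x"

text \<open>Left multiplication \<open>h \<cdot> (a \<otimes> v) = (h a) \<otimes> v\<close>, in the style of \<^const>\<open>rcoset_mult\<close>.\<close>

definition tensor_act ::
    "('a, 'm) ring_scheme \<Rightarrow> 'a set \<Rightarrow> ('a \<Rightarrow> 'v \<Rightarrow> 'v) \<Rightarrow>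
      'a \<Rightarrow> (('a \<times> 'v::ab_group_add) \<Rightarrow>\<^sub>0 int) set \<Rightarrow> (('a \<times> 'v) \<Rightarrow>\<^sub>0 int) set" where
  "tensor_act A S act h X =
     (\<Union>x\<in>X. tensor_cls A S act (frag_extend (\<lambda>(a, v). frag_of (h \<otimes>\<^bsub>A\<^esub> a, v)) x))"

definition h_xi :: "nat \<Rightarrow> complex \<Rightarrow> spin_gen falg set set" where
  "h_xi n u = generate_ring (daha n u)
     (daha_cls n u ` (carrier (free_alg (spin_gens n)) \<union> xi_gen ` {1..n}))"

text \<open>
  The extension of a module over the spin group algebra to \<open>h_xi\<close> by letting the
  \<open>\<xi>\<^sub>i\<close> act by zero: \<open>xi_ext_graph n u act a v w\<close> says that \<open>a \<in> h_xi\<close> maps \<open>v\<close> to \<open>w\<close>.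
  It is single-valued by the triangular decomposition.
\<close>

inductive xi_ext_graph ::
    "nat \<Rightarrow> complex \<Rightarrow> (spin_gen falg set \<Rightarrow> 'v::ab_group_add \<Rightarrow> 'v) \<Rightarrow>
      spin_gen falg set \<Rightarrow> 'v \<Rightarrow> 'v \<Rightarrow> bool"
  for n :: nat and u :: complex and act :: "spin_gen falg set \<Rightarrow> 'v::ab_group_add \<Rightarrow> 'v"
where
  spin: "p \<in> carrier (free_alg (spin_gens n)) \<Longrightarrow>
     xi_ext_graph n u act (daha_cls n u p) v (act (spin_cls n p) v)"
| xi: "i \<in> {1..n} \<Longrightarrow> xi_ext_graph n u act (daha_cls n u (xi_gen i)) v 0"
| add: "xi_ext_graph n u act a v w \<Longrightarrow> xi_ext_graph n u act b v w' \<Longrightarrow>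
     xi_ext_graph n u act (a \<oplus>\<^bsub>daha n u\<^esub> b) v (w + w')"
| mult: "xi_ext_graph n u act b v w \<Longrightarrow> xi_ext_graph n u act a w w' \<Longrightarrow>
     xi_ext_graph n u act (a \<otimes>\<^bsub>daha n u\<^esub> b) v w'"

definition xi_ext ::
    "nat \<Rightarrow> complex \<Rightarrow> (spin_gen falg set \<Rightarrow> 'v::ab_group_add \<Rightarrow> 'v) \<Rightarrow>
      spin_gen falg set \<Rightarrow> 'v \<Rightarrow> 'v" where
  "xi_ext n u act a v = (THE w. xi_ext_graph n u act a v w)"

definition V_xi ::
    "nat \<Rightarrow> complex \<Rightarrow> (spin_gen falg set \<Rightarrow> 'v::ab_group_add \<Rightarrow> 'v) \<Rightarrow>
      ((spin_gen falg set \<times> 'v) \<Rightarrow>\<^sub>0 int) set monoid" where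
  "V_xi n u act = tensor (daha n u) (h_xi n u) (xi_ext n u act)"

definition V_xi_cls ::
    "nat \<Rightarrow> complex \<Rightarrow> (spin_gen falg set \<Rightarrow> 'v::ab_group_add \<Rightarrow> 'v) \<Rightarrow>
      ((spin_gen falg set \<times> 'v) \<Rightarrow>\<^sub>0 int) \<Rightarrow> ((spin_gen falg set \<times> 'v) \<Rightarrow>\<^sub>0 int) set" where
  "V_xi_cls n u act = tensor_cls (daha n u) (h_xi n u) (xi_ext n u act)"

definition V_xi_act ::
    "nat \<Rightarrow> complex \<Rightarrow> (spin_gen falg set \<Rightarrow> 'v::ab_group_add \<Rightarrow> 'v) \<Rightarrow>
      spin_gen falg set \<Rightarrow> ((spin_gen falg set \<times> 'v) \<Rightarrow>\<^sub>0 int) set \<Rightarrow>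
      ((spin_gen falg set \<times> 'v) \<Rightarrow>\<^sub>0 int) set" where
  "V_xi_act n u act = tensor_act (daha n u) (h_xi n u) (xi_ext n u act)"


section \<open>Polynomials and the module structure on polynomials tensor V\<close>

text \<open>
  Polynomials with coefficients in \<open>'b\<close>, involving only the variables \<open>y\<^sub>1, \<dots>, y\<^sub>n\<close>.
  With \<open>'b\<close> the complex numbers this is the polynomial ring; with \<open>'b\<close> the space \<open>V\<close>
  it is the tensor product over the complex numbers of the polynomial ring with \<open>V\<close>.
\<close>

definition polys :: "nat \<Rightarrow> ((nat \<Rightarrow>\<^sub>0 nat) \<Rightarrow>\<^sub>0 'b::zero) set" where
  "polys n = {f. \<forall>m\<in>Poly_Mapping.keys f. Poly_Mapping.keys m \<subseteq> {1..n}}"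

definition pvar :: "nat \<Rightarrow> (nat \<Rightarrow>\<^sub>0 nat) \<Rightarrow>\<^sub>0 complex" where
  "pvar j = Poly_Mapping.single (Poly_Mapping.single j 1) 1"

text \<open>
  \<open>f\<^sup>\<sigma>\<close>, obtained by substituting \<open>y\<^bsub>\<sigma> j\<^esub>\<close> for \<open>y\<^sub>j\<close>: the coefficient of the
  result at the monomial \<open>m\<close> is the coefficient of \<open>f\<close> at \<open>m \<circ> \<sigma>\<close>.
\<close>

definition perm_poly ::
    "(nat \<Rightarrow> nat) \<Rightarrow> ((nat \<Rightarrow>\<^sub>0 nat) \<Rightarrow>\<^sub>0 complex) \<Rightarrow> (nat \<Rightarrow>\<^sub>0 nat) \<Rightarrow>\<^sub>0 complex" where
  "perm_poly \<sigma> f = Poly_Mapping.map_key (Poly_Mapping.map_key \<sigma>) f"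

definition exact_quot :: "'a::idom \<Rightarrow> 'a \<Rightarrow> 'a" where
  "exact_quot f g = (THE q. q * g = f)"

definition vscale ::
    "nat \<Rightarrow> (spin_gen falg set \<Rightarrow> 'v::ab_group_add \<Rightarrow> 'v) \<Rightarrow> complex \<Rightarrow> 'v \<Rightarrow> 'v" where
  "vscale n act c v = act (spin_cls n (const c)) v"

definition pscale ::
    "nat \<Rightarrow> (spin_gen falg set \<Rightarrow> 'v::ab_group_add \<Rightarrow> 'v) \<Rightarrow> complex \<Rightarrow>
      ((nat \<Rightarrow>\<^sub>0 nat) \<Rightarrow>\<^sub>0 'v) \<Rightarrow> (nat \<Rightarrow>\<^sub>0 nat) \<Rightarrow>\<^sub>0 'v" where
  "pscale n act c = Poly_Mapping.map (vscale n act c)"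

text \<open>The pure tensor \<open>f \<otimes> v\<close>.\<close>

definition ptensor ::
    "nat \<Rightarrow> (spin_gen falg set \<Rightarrow> 'v::ab_group_add \<Rightarrow> 'v) \<Rightarrow>
      ((nat \<Rightarrow>\<^sub>0 nat) \<Rightarrow>\<^sub>0 complex) \<Rightarrow> 'v \<Rightarrow> (nat \<Rightarrow>\<^sub>0 nat) \<Rightarrow>\<^sub>0 'v" where
  "ptensor n act f v = Poly_Mapping.map (\<lambda>c. vscale n act c v) f"

definition y_monom :: "nat \<Rightarrow> (nat \<Rightarrow>\<^sub>0 nat) \<Rightarrow> spin_gen falg" where
  "y_monom n m = prod_list (map (\<lambda>j. y_gen j ^ Poly_Mapping.lookup m j) [1..<n+1])"

text \<open>
  The identification of polynomials tensor \<open>V\<close> with the induced module, which sends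
  \<open>y\<^sup>m \<otimes> v\<close> to the class of \<open>y\<^sup>m \<otimes> v\<close>. It is bijective from \<open>polys n\<close> onto the
  induced module by the triangular decomposition.
\<close>

definition V_xi_ident ::
    "nat \<Rightarrow> complex \<Rightarrow> (spin_gen falg set \<Rightarrow> 'v::ab_group_add \<Rightarrow> 'v) \<Rightarrow>
      ((nat \<Rightarrow>\<^sub>0 nat) \<Rightarrow>\<^sub>0 'v) \<Rightarrow> ((spin_gen falg set \<times> 'v) \<Rightarrow>\<^sub>0 int) set" where
  "V_xi_ident n u act p = V_xi_cls n u act
     (\<Sum>m\<in>Poly_Mapping.keys p. frag_of (daha_cls n u (y_monom n m), Poly_Mapping.lookup p m))"

text \<open>The action of the Hecke algebra on polynomials tensor \<open>V\<close>, by transport of structure.\<close>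

definition poly_act ::
    "nat \<Rightarrow> complex \<Rightarrow> (spin_gen falg set \<Rightarrow> 'v::ab_group_add \<Rightarrow> 'v) \<Rightarrow>
      spin_gen falg set \<Rightarrow> ((nat \<Rightarrow>\<^sub>0 nat) \<Rightarrow>\<^sub>0 'v) \<Rightarrow> (nat \<Rightarrow>\<^sub>0 nat) \<Rightarrow>\<^sub>0 'v" where
  "poly_act n u act h p =
     the_inv_into (polys n) (V_xi_ident n u act) (V_xi_act n u act h (V_xi_ident n u act p))"

end

theory Submission
  imports Defs
begin

text \<open>
  Let \<open>t\<^sub>i\<close>, \<open>y\<^sub>i\<close> and \<open>\<xi>\<^sub>i\<close> act on polynomials with coefficients in \<open>V\<close> by \<open>s\<^sub>i \<otimes> t\<^sub>i\<close>, multiplication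
  and the Dunkl operator. These operators satisfy the defining relations of the Hecke algebra. The only
  laborious one is the anticommutation of two Dunkl operators: by the remaining relations
  \<open>\<xi>\<^sub>i \<xi>\<^sub>j + \<xi>\<^sub>j \<xi>\<^sub>i\<close> commutes with every \<open>y\<^sub>k\<close>, and it kills \<open>1 \<otimes> V\<close>, hence it vanishes. In the resulting
  module \<open>1 \<otimes> V\<close> is killed by the \<open>\<xi>\<^sub>i\<close>, so \<open>a \<otimes> v \<mapsto> a (1 \<otimes> v)\<close> is a well-defined module map from the induced
  module, and it is a left inverse of the identification \<open>y\<^sup>m \<otimes> v \<mapsto> y\<^sup>m \<otimes> v\<close>. The commutation relations
  show that the image of the identification is stable under \<open>\<xi>\<^sub>i\<close>, so that the transported action of
  \<open>\<xi>\<^sub>i\<close> is the Dunkl operator. The triangular decomposition is not presupposed.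
\<close>

section \<open>Finitely supported functions as sums of single terms\<close>

lemma poly_mapping_sum_singles:
  "(\<Sum>k\<in>Poly_Mapping.keys p. Poly_Mapping.single k (Poly_Mapping.lookup p k)) = p"
proof (rule poly_mapping_eqI)
  fix m
  show "Poly_Mapping.lookup (\<Sum>k\<in>Poly_Mapping.keys p. Poly_Mapping.single k (Poly_Mapping.lookup p k)) m
    = Poly_Mapping.lookup p m"
    by (cases "m \<in> Poly_Mapping.keys p")
      (auto simp: lookup_sum lookup_single when_def sum.delta in_keys_iff)
qed

text \<open>The sum of singles is built up over subsets of the support. The case
  \<open>single\<close> is restricted to keys of the given \<open>p\<close>, so that a support
  condition on \<open>p\<close> remains available there.\<close>

lemma poly_mapping_single_induct [case_names zero single add]:
  fixes p :: "'a \<Rightarrow>\<^sub>0 'b::comm_monoid_add"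
  assumes "P 0"
    and "\<And>k c. k \<in> Poly_Mapping.keys p \<Longrightarrow> P (Poly_Mapping.single k c)"
    and "\<And>p q. P p \<Longrightarrow> P q \<Longrightarrow> P (p + q)"
  shows "P p"
proof -
  have "P (\<Sum>k\<in>K. Poly_Mapping.single k (Poly_Mapping.lookup p k))"
    if "finite K" "K \<subseteq> Poly_Mapping.keys p" for K
    using that by (induction K) (auto intro: assms)
  from this[of "Poly_Mapping.keys p"] show ?thesis
    by (simp add: poly_mapping_sum_singles)
qed

text \<open>The common pattern behind evaluation of noncommutative polynomials (\<open>ev\<close>),
  operators on vector-valued polynomials (\<open>lin\<close>) and evaluation of tensors
  (\<open>psi\<close>): a map prescribed on single terms, additive as soon as each
  \<open>h k\<close> is.\<close>

definition pm_sum :: "('a \<Rightarrow> 'b::zero \<Rightarrow> 'c::comm_monoid_add) \<Rightarrow> ('a \<Rightarrow>\<^sub>0 'b) \<Rightarrow> 'c" where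
  "pm_sum h p = (\<Sum>k\<in>Poly_Mapping.keys p. h k (Poly_Mapping.lookup p k))"

lemma pm_sum_zero [simp]: "pm_sum h 0 = 0"
  by (simp add: pm_sum_def)

lemma pm_sum_single: "h k 0 = 0 \<Longrightarrow> pm_sum h (Poly_Mapping.single k c) = h k c"
  by (cases "c = 0") (simp_all add: pm_sum_def)

lemma pm_sum_add:
  fixes p q :: "'a \<Rightarrow>\<^sub>0 'b::ab_group_add" and h :: "'a \<Rightarrow> 'b \<Rightarrow> 'c::ab_group_add"
  assumes "\<And>k. additive (h k)"
  shows "pm_sum h (p + q) = pm_sum h p + pm_sum h q"
  unfolding pm_sum_def
  by (rule setsum_keys_plus_distrib) (simp_all add: additive.zero[OF assms] additive.add[OF assms])

section \<open>Presented algebras\<close>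

abbreviation fcar :: "'g set \<Rightarrow> 'g falg set" where
  "fcar G \<equiv> carrier (free_alg G)"

lemma free_alg_sel [simp]:
  "mult (free_alg G) = (*)" "one (free_alg G) = 1"
  "ring.zero (free_alg G) = 0" "add (free_alg G) = (+)"
  by (simp_all add: free_alg_def)

lemma fcar_iff: "p \<in> fcar G \<longleftrightarrow> (\<forall>w\<in>Poly_Mapping.keys p. set (letters w) \<subseteq> G)"
  by (simp add: free_alg_def)

lemma fcar_zero [simp]: "0 \<in> fcar G"
  by (simp add: fcar_iff)

lemma fcar_const [simp]: "const c \<in> fcar G"
  by (auto simp: fcar_iff const_def zero_fmon_def)

lemma const_one [simp]: "const 1 = 1"
  by (simp add: const_def)

lemma fcar_one [simp]: "1 \<in> fcar G"
  using fcar_const[of 1 G] by simp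

lemma fcar_gen [simp]: "gen g \<in> fcar G \<longleftrightarrow> g \<in> G"
  by (simp add: fcar_iff gen_def)

lemma fcar_add [simp]: "p \<in> fcar G \<Longrightarrow> q \<in> fcar G \<Longrightarrow> p + q \<in> fcar G"
  using keys_add[of p q] by (auto simp: fcar_iff)

lemma fcar_uminus [simp]: "- p \<in> fcar G \<longleftrightarrow> p \<in> fcar G"
  by (auto simp: fcar_iff)

lemma fcar_diff [simp]: "p \<in> fcar G \<Longrightarrow> q \<in> fcar G \<Longrightarrow> p - q \<in> fcar G"
  using fcar_add[of p G "- q"] by simp

lemma fcar_mult [simp]: "p \<in> fcar G \<Longrightarrow> q \<in> fcar G \<Longrightarrow> p * q \<in> fcar G"
  using keys_mult[of p q] by (fastforce simp: fcar_iff plus_fmon_def)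

lemma fcar_power [simp]: "p \<in> fcar G \<Longrightarrow> p ^ k \<in> fcar G"
  by (induction k) auto

lemma fcar_sum [simp]: "(\<And>k. k \<in> K \<Longrightarrow> f k \<in> fcar G) \<Longrightarrow> sum f K \<in> fcar G"
  by (induction K rule: infinite_finite_induct) auto

lemma fcar_prod_list [simp]: "(\<And>p. p \<in> set ps \<Longrightarrow> p \<in> fcar G) \<Longrightarrow> prod_list ps \<in> fcar G"
  by (induction ps) auto

lemma fcar_mono: "G \<subseteq> H \<Longrightarrow> p \<in> fcar G \<Longrightarrow> p \<in> fcar H"
  by (auto simp: fcar_iff)

lemma ring_free_alg: "ring (free_alg G)"
proof (rule ringI)
  show "abelian_group (free_alg G)"
    by (rule abelian_groupI) (auto simp: add.assoc add.commute intro!: bexI[of _ "- x" for x])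
  show "Group.monoid (free_alg G)"
    by (rule monoidI) (auto simp: mult.assoc)
qed (auto simp: algebra_simps)

lemma free_alg_a_inv: "p \<in> fcar G \<Longrightarrow> \<ominus>\<^bsub>free_alg G\<^esub> p = - p"
proof -
  assume p: "p \<in> fcar G"
  interpret ring "free_alg G" by (rule ring_free_alg)
  show ?thesis
    by (rule minus_equality) (use p in auto)
qed

text \<open>Elements are sums of scaled words, and words are products of generators. The cases
  retain membership in \<open>fcar G\<close> because passing to classes is additive and
  multiplicative only there.\<close>

lemma free_alg_induct [consumes 1, case_names zero const gen add mult]:
  assumes p: "p \<in> fcar G"
    and zero: "P 0"
    and const: "\<And>c. P (const c)"
    and gen: "\<And>g. g \<in> G \<Longrightarrow> P (gen g)"
    and add: "\<And>p q. p \<in> fcar G \<Longrightarrow> q \<in> fcar G \<Longrightarrow> P p \<Longrightarrow> P q \<Longrightarrow> P (p + q)"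
    and mult: "\<And>p q. p \<in> fcar G \<Longrightarrow> q \<in> fcar G \<Longrightarrow> P p \<Longrightarrow> P q \<Longrightarrow> P (p * q)"
  shows "P p"
proof -
  have s: "set ws \<subseteq> G \<Longrightarrow> Poly_Mapping.single (FMon ws) c \<in> fcar G \<and> P (Poly_Mapping.single (FMon ws) c)"
    for ws c
  proof (induction ws)
    case Nil
    then show ?case using const[of c] fcar_const[of c G] by (simp add: const_def zero_fmon_def)
  next
    case (Cons a ws)
    have "Poly_Mapping.single (FMon (a # ws)) c = gen a * Poly_Mapping.single (FMon ws) c"
      by (simp add: gen_def mult_single plus_fmon_def)
    with Cons show ?case by (auto intro!: mult gen)
  qed
  have "p \<in> fcar G \<and> P p"
  proof (induction p rule: poly_mapping_single_induct)
    case (single k c)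
    then have "set (letters k) \<subseteq> G" using p by (simp add: fcar_iff)
    from s[OF this, of c] show ?case by simp
  qed (auto intro: zero add)
  then show ?thesis ..
qed

locale presentation =
  fixes G :: "'g set" and R :: "'g falg set"
  assumes rels: "R \<subseteq> fcar G"
begin

abbreviation "A \<equiv> presented_alg G R"
abbreviation "cls \<equiv> presented_cls G R"
abbreviation "I \<equiv> Idl\<^bsub>free_alg G\<^esub> R"

lemma ideal_I: "ideal I (free_alg G)"
  by (rule ring.genideal_ideal[OF ring_free_alg rels])

lemma ring_A: "ring A"
  unfolding presented_alg_def by (rule ideal.quotient_is_ring[OF ideal_I])

lemma cls_hom: "cls \<in> ring_hom (free_alg G) A"
proof -
  have "cls = (+>\<^bsub>free_alg G\<^esub>) I" by (auto simp: presented_cls_def)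
  then show ?thesis using ideal.rcos_ring_hom[OF ideal_I] by (simp add: presented_alg_def)
qed

lemma cls_closed [simp]: "p \<in> fcar G \<Longrightarrow> cls p \<in> carrier A"
  using cls_hom by (rule ring_hom_closed)

lemma cls_add: "p \<in> fcar G \<Longrightarrow> q \<in> fcar G \<Longrightarrow> cls (p + q) = cls p \<oplus>\<^bsub>A\<^esub> cls q"
  using ring_hom_add[OF cls_hom, of p q] by simp

lemma cls_mult: "p \<in> fcar G \<Longrightarrow> q \<in> fcar G \<Longrightarrow> cls (p * q) = cls p \<otimes>\<^bsub>A\<^esub> cls q"
  using ring_hom_mult[OF cls_hom, of p q] by simp

lemma cls_one: "cls 1 = \<one>\<^bsub>A\<^esub>"
  using ring_hom_one[OF cls_hom] by simp

lemma carrier_A: "carrier A = cls ` fcar G"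
  by (auto simp: presented_alg_def presented_cls_def FactRing_def A_RCOSETS_def' a_r_coset_def)

lemma cls_eq_iff: "p \<in> fcar G \<Longrightarrow> q \<in> fcar G \<Longrightarrow> cls p = cls q \<longleftrightarrow> p - q \<in> I"
  using ring.quotient_eq_iff_same_a_r_cos[OF ring_free_alg ideal_I, of p q]
  by (simp add: presented_cls_def a_minus_def free_alg_a_inv)

lemma cls_eqI: "p - q \<in> R \<Longrightarrow> p \<in> fcar G \<Longrightarrow> q \<in> fcar G \<Longrightarrow> cls p = cls q"
  using ring.genideal_self[OF ring_free_alg rels] by (auto simp: cls_eq_iff)

end

section \<open>Representations of free algebras\<close>

locale free_rep = Modules.module s
  for s :: "complex \<Rightarrow> 'w::ab_group_add \<Rightarrow> 'w" +
  fixes \<rho> :: "'g \<Rightarrow> 'w \<Rightarrow> 'w"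
  assumes rho_add: "\<rho> g (x + y) = \<rho> g x + \<rho> g y"
    and rho_scale: "\<rho> g (s c x) = s c (\<rho> g x)"
begin

text \<open>The extension of \<rho> to the free algebra: the letters of a word are applied from
  right to left, so that products act by composition.\<close>

definition ev :: "'g falg \<Rightarrow> 'w \<Rightarrow> 'w" where
  "ev p x = pm_sum (\<lambda>w c. s c (foldr \<rho> (letters w) x)) p"

lemma ev_zero [simp]: "ev 0 x = 0"
  by (simp add: ev_def)

lemma ev_single: "ev (Poly_Mapping.single w c) x = s c (foldr \<rho> (letters w) x)"
  by (simp add: ev_def pm_sum_single)

lemma ev_const [simp]: "ev (const c) x = s c x"
  by (simp add: const_def ev_single zero_fmon_def)

lemma ev_one [simp]: "ev 1 x = x"
  using ev_const[of 1 x] by simp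

lemma ev_gen [simp]: "ev (gen g) x = \<rho> g x"
  by (simp add: gen_def ev_single)

lemma ev_add [simp]: "ev (p + q) x = ev p x + ev q x"
  unfolding ev_def
  by (rule pm_sum_add) (simp add: additive_def scale_left_distrib)

lemma ev_uminus [simp]: "ev (- p) x = - ev p x"
  using ev_add[of p "- p" x] by (simp add: add_eq_0_iff)

lemma ev_diff [simp]: "ev (p - q) x = ev p x - ev q x"
  using ev_add[of p "- q" x] by simp

lemma ev_sum: "ev (sum f K) x = (\<Sum>k\<in>K. ev (f k) x)"
  by (induction K rule: infinite_finite_induct) auto

lemma foldr_rho_linear:
  "foldr \<rho> ws (x + y) = foldr \<rho> ws x + foldr \<rho> ws y"
  "foldr \<rho> ws (s c x) = s c (foldr \<rho> ws x)"
  by (induction ws) (auto simp: rho_add rho_scale)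

lemma ev_scale: "ev p (s c x) = s c (ev p x)"
  by (induction p rule: poly_mapping_single_induct)
    (auto simp: ev_single foldr_rho_linear scale_right_distrib mult.commute)

lemma ev_add_right [simp]: "ev p (x + y) = ev p x + ev p y"
  by (induction p rule: poly_mapping_single_induct)
    (auto simp: ev_single foldr_rho_linear scale_right_distrib)

lemma ev_zero_right [simp]: "ev p 0 = 0"
  using ev_add_right[of p 0 0] by simp

lemma ev_mult [simp]: "ev (p * q) x = ev p (ev q x)"
proof (induction p rule: poly_mapping_single_induct)
  case (single k c)
  show ?case
  proof (induction q rule: poly_mapping_single_induct)
    case (single l d)
    then show ?case
      by (simp add: mult_single ev_single plus_fmon_def foldr_rho_linear)
  qed (auto simp: distrib_left)
qed (auto simp: distrib_right)

text \<open>The elements acting by zero form a two-sided ideal, which contains the ideal generated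
  by \<open>R\<close> once it contains \<open>R\<close>. Hence the action descends to the presented
  algebra.\<close>

lemma ev_ideal:
  assumes R: "R \<subseteq> fcar G" and z: "\<And>r x. r \<in> R \<Longrightarrow> ev r x = 0"
    and p: "p \<in> Idl\<^bsub>free_alg G\<^esub> R"
  shows "ev p x = 0"
proof -
  let ?K = "{p \<in> fcar G. \<forall>x. ev p x = 0}"
  have "ideal ?K (free_alg G)"
  proof (rule idealI[OF ring_free_alg])
    show "subgroup ?K (add_monoid (free_alg G))"
      by (rule group.subgroupI[OF abelian_group.a_group[OF ring.is_abelian_group[OF ring_free_alg]]])
        (auto simp: free_alg_a_inv[unfolded a_inv_def, simplified] intro: exI[of _ 0])
  qed auto
  moreover have "R \<subseteq> ?K" using R z by auto
  ultimately have "Idl\<^bsub>free_alg G\<^esub> R \<subseteq> ?K"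
    by (rule ring.genideal_minimal[OF ring_free_alg])
  with p show ?thesis by auto
qed

lemma ev_cls_cong:
  assumes R: "R \<subseteq> fcar G" and z: "\<And>r x. r \<in> R \<Longrightarrow> ev r x = 0"
    and "p \<in> fcar G" "q \<in> fcar G" "presented_cls G R p = presented_cls G R q"
  shows "ev p x = ev q x"
proof -
  interpret presentation G R by (unfold_locales) (rule R)
  have "ev (p - q) x = 0"
    using cls_eq_iff assms by (intro ev_ideal[OF R z]) auto
  then show ?thesis by simp
qed

end

section \<open>Divided differences\<close>

type_synonym cpoly = "(nat \<Rightarrow>\<^sub>0 nat) \<Rightarrow>\<^sub>0 complex"

text \<open>Tailored to operators whose commutation with multiplication by one variable is known:
  every monomial is reached from a constant one variable at a time.\<close>

lemma cpoly_induct [case_names const add var]: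
  fixes p :: cpoly
  assumes C: "\<And>c. P (Poly_Mapping.single 0 c)"
    and A: "\<And>p q. P p \<Longrightarrow> P q \<Longrightarrow> P (p + q)"
    and V: "\<And>j p. P p \<Longrightarrow> P (pvar j * p)"
  shows "P p"
proof -
  have m: "\<forall>p. P p \<longrightarrow> P (Poly_Mapping.single m 1 * p)" for m :: "nat \<Rightarrow>\<^sub>0 nat"
  proof (induction m rule: poly_mapping_single_induct)
    case (single j e)
    show ?case
    proof (induction e)
      case (Suc e)
      have "Poly_Mapping.single (Poly_Mapping.single j (Suc e)) 1
          = pvar j * Poly_Mapping.single (Poly_Mapping.single j e) 1"
        by (simp add: pvar_def mult_single flip: single_add)
      with Suc V show ?case by (auto simp: mult.assoc)
    qed simp
  next
    case (add l m)
    have "Poly_Mapping.single (l + m) 1 = Poly_Mapping.single l 1 * (Poly_Mapping.single m 1 :: cpoly)"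
      by (simp add: mult_single)
    with add show ?case by (simp add: mult.assoc)
  qed simp
  show ?thesis
  proof (induction p rule: poly_mapping_single_induct)
    case zero
    show ?case using C[of 0] by simp
  next
    case (single k c)
    have "Poly_Mapping.single k c = Poly_Mapping.single k 1 * Poly_Mapping.single 0 c"
      by (simp add: mult_single)
    then show ?case using m C by metis
  qed (rule A)
qed

section \<open>Permutation of the variables\<close>

lemma lookup_map_key: "inj \<sigma> \<Longrightarrow> Poly_Mapping.lookup (Poly_Mapping.map_key \<sigma> m) j = Poly_Mapping.lookup m (\<sigma> j)"
  by (simp add: Poly_Mapping.map_key.rep_eq)

lemma map_key_inverse:
  assumes "bij \<sigma>"
  shows "Poly_Mapping.map_key \<sigma> (Poly_Mapping.map_key (inv_into UNIV \<sigma>) m) = m"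
    and "Poly_Mapping.map_key (inv_into UNIV \<sigma>) (Poly_Mapping.map_key \<sigma> m) = m"
  using assms bij_imp_bij_inv[OF assms]
  by (auto intro!: poly_mapping_eqI simp: lookup_map_key bij_is_inj bij_is_surj surj_f_inv_f)

lemma inj_map_key: "bij \<sigma> \<Longrightarrow> inj (Poly_Mapping.map_key \<sigma>)"
  for \<sigma> :: "'a \<Rightarrow> 'a"
  by (rule inj_on_inverseI) (rule map_key_inverse(2)[of \<sigma>])

text \<open>\<open>perm_poly\<close> pulls coefficients back along a relabelling of exponents, so a
  single monomial is moved by the inverse relabelling.\<close>

lemma perm_poly_single:
  assumes "bij \<sigma>"
  shows "perm_poly \<sigma> (Poly_Mapping.single m c) = Poly_Mapping.single (Poly_Mapping.map_key (inv_into UNIV \<sigma>) m) c"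
  using map_key_single[OF inj_map_key[OF assms], of "Poly_Mapping.map_key (inv_into UNIV \<sigma>) m" c]
  by (simp add: perm_poly_def map_key_inverse[OF assms])

lemma perm_poly_add: "bij \<sigma> \<Longrightarrow> perm_poly \<sigma> (f + g) = perm_poly \<sigma> f + perm_poly \<sigma> g"
  by (simp add: perm_poly_def map_key_plus inj_map_key)

lemma additive_perm_poly: "bij \<sigma> \<Longrightarrow> additive (perm_poly \<sigma>)"
  by (simp add: additive_def perm_poly_add)

lemma perm_poly_diff: "bij \<sigma> \<Longrightarrow> perm_poly \<sigma> (f - g) = perm_poly \<sigma> f - perm_poly \<sigma> g"
  by (rule additive.diff[OF additive_perm_poly])

lemma perm_poly_const [simp]:
  "bij \<sigma> \<Longrightarrow> perm_poly \<sigma> (Poly_Mapping.single 0 c) = Poly_Mapping.single 0 c"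
  by (simp add: perm_poly_single bij_imp_bij_inv bij_is_inj)

lemma perm_poly_pvar [simp]: "bij \<sigma> \<Longrightarrow> perm_poly \<sigma> (pvar j) = pvar (\<sigma> j)"
  using map_key_single[of "inv_into UNIV \<sigma>" "\<sigma> j" "Suc 0"]
  by (simp add: pvar_def perm_poly_single bij_imp_bij_inv bij_is_inj)

lemma perm_poly_mult:
  assumes "bij \<sigma>"
  shows "perm_poly \<sigma> (f * g) = perm_poly \<sigma> f * perm_poly \<sigma> g"
proof (induction f rule: poly_mapping_single_induct)
  case zero
  show ?case by (simp add: additive.zero[OF additive_perm_poly[OF assms]])
next
  case (single k c)
  show ?case
  proof (induction g rule: poly_mapping_single_induct)
    case zero
    show ?case by (simp add: additive.zero[OF additive_perm_poly[OF assms]])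
  next
    case (single l d)
    show ?case using bij_imp_bij_inv[OF assms]
      by (simp add: mult_single perm_poly_single assms map_key_plus bij_is_inj)
  qed (simp add: distrib_left perm_poly_add assms)
qed (simp add: distrib_right perm_poly_add assms)

text \<open>Precomposition reverses the order once on exponents and once more on coefficients; the
  two reversals cancel and leave a left action.\<close>

lemma perm_poly_comp:
  assumes "bij \<sigma>" "bij \<tau>"
  shows "perm_poly \<sigma> (perm_poly \<tau> f) = perm_poly (\<sigma> \<circ> \<tau>) f"
proof -
  have "Poly_Mapping.map_key \<tau> \<circ> Poly_Mapping.map_key \<sigma>
      = (Poly_Mapping.map_key (\<sigma> \<circ> \<tau>) :: (nat \<Rightarrow>\<^sub>0 nat) \<Rightarrow> _)"
    using assms by (auto simp: map_key_compose bij_is_inj)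
  then show ?thesis
    using assms by (simp add: perm_poly_def map_key_compose inj_map_key)
qed

lemma perm_poly_id [simp]: "perm_poly id f = f"
proof -
  have "Poly_Mapping.map_key id = (id :: (nat \<Rightarrow>\<^sub>0 nat) \<Rightarrow> _)"
    by (simp add: fun_eq_iff id_def map_key_id)
  then show ?thesis by (simp add: perm_poly_def) (simp add: id_def map_key_id)
qed

lemma pvar_diff_nonzero: "i \<noteq> k \<Longrightarrow> pvar i - pvar k \<noteq> 0"
proof
  assume "i \<noteq> k" "pvar i - pvar k = 0"
  then have "Poly_Mapping.lookup (pvar i) (Poly_Mapping.single i 1)
      = Poly_Mapping.lookup (pvar k) (Poly_Mapping.single i 1)" by simp
  moreover have "Poly_Mapping.single i 1 \<noteq> (Poly_Mapping.single k 1 :: nat \<Rightarrow>\<^sub>0 nat)"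
    using \<open>i \<noteq> k\<close> by (metis lookup_single_eq lookup_single_not_eq one_neq_zero)
  ultimately show False by (simp add: pvar_def lookup_single when_def split: if_splits)
qed

text \<open>The divided difference of the reflection exchanging \<open>y_i\<close> and
  \<open>y_k\<close>; that the quotient exists is shown in \<open>div_diff_eq\<close>.\<close>

definition div_diff :: "nat \<Rightarrow> nat \<Rightarrow> cpoly \<Rightarrow> cpoly" where
  "div_diff i k f = exact_quot (f - perm_poly (transpose k i) f) (pvar i - pvar k)"

lemma div_diff_eqI:
  "i \<noteq> k \<Longrightarrow> q * (pvar i - pvar k) = f - perm_poly (transpose k i) f \<Longrightarrow> div_diff i k f = q"
  unfolding div_diff_def exact_quot_def
  by (rule the_equality) (simp, metis mult_right_cancel pvar_diff_nonzero)

text \<open>Divisibility follows from the twisted Leibniz rule: with \<open>s\<close> the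
  transposition, \<open>y_j f - s(y_j f) = y_j (f - s f) + (y_j - s y_j) (s f)\<close>, and the
  factor \<open>y_j - s y_j\<close> is a multiple of \<open>y_i - y_k\<close>.\<close>

lemma div_diff_eq:
  assumes "i \<noteq> k"
  shows "div_diff i k f * (pvar i - pvar k) = f - perm_poly (transpose k i) f"
proof -
  have "\<exists>q. q * (pvar i - pvar k) = f - perm_poly (transpose k i) f"
  proof (induction f rule: cpoly_induct)
    case (const c)
    show ?case by (rule exI[of _ 0]) simp
  next
    case (add f g)
    then obtain q r where "q * (pvar i - pvar k) = f - perm_poly (transpose k i) f"
      "r * (pvar i - pvar k) = g - perm_poly (transpose k i) g" by blast
    then have "(q + r) * (pvar i - pvar k) = (f + g) - perm_poly (transpose k i) (f + g)"
      by (simp add: distrib_right perm_poly_add)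
    then show ?case ..
  next
    case (var j f)
    then obtain q where q: "q * (pvar i - pvar k) = f - perm_poly (transpose k i) f" by blast
    \<comment> \<open>The quotient of \<open>y_j - s y_j\<close> by \<open>y_i - y_k\<close>, which
      is also the divided difference of \<open>y_j\<close>.\<close>
    define e :: cpoly where "e = (if j = i then 1 else if j = k then -1 else 0)"
    have e: "pvar j - pvar (transpose k i j) = e * (pvar i - pvar k)"
      using assms by (auto simp: e_def transpose_def)
    have "(pvar j * q + e * perm_poly (transpose k i) f) * (pvar i - pvar k)
      = pvar j * (q * (pvar i - pvar k)) + (e * (pvar i - pvar k)) * perm_poly (transpose k i) f"
      by (simp add: algebra_simps)
    also have "\<dots> = pvar j * f - perm_poly (transpose k i) (pvar j * f)"
      unfolding q e[symmetric] by (simp add: perm_poly_mult algebra_simps)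
    finally show ?case by blast
  qed
  then show ?thesis using div_diff_eqI[OF assms] by auto
qed

context
  fixes i k :: nat
  assumes ik: "i \<noteq> k"
begin

lemma div_diff_add: "div_diff i k (f + g) = div_diff i k f + div_diff i k g"
  by (rule div_diff_eqI[OF ik]) (simp add: distrib_right div_diff_eq[OF ik] perm_poly_add)

lemma div_diff_scale:
  "div_diff i k (Poly_Mapping.single 0 c * f) = Poly_Mapping.single 0 c * div_diff i k f"
  by (rule div_diff_eqI[OF ik])
    (simp only: mult.assoc div_diff_eq[OF ik] perm_poly_mult bij_transpose perm_poly_const,
     simp only: right_diff_distrib)

lemma div_diff_one: "div_diff i k 1 = 0"
  by (rule div_diff_eqI[OF ik]) (simp flip: single_one)

lemma div_diff_pvar:
  "div_diff i k (pvar j * f) = pvar j * div_diff i k f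
    + (if j = i then perm_poly (transpose k i) f
       else if j = k then - perm_poly (transpose k i) f else 0)"
proof (rule div_diff_eqI[OF ik])
  let ?s = "perm_poly (transpose k i) f"
  have "(pvar j * div_diff i k f + (if j = i then ?s else if j = k then - ?s else 0)) * (pvar i - pvar k)
     = pvar j * (f - ?s) + (if j = i then ?s else if j = k then - ?s else 0) * (pvar i - pvar k)"
    by (simp add: distrib_right mult.assoc div_diff_eq[OF ik] del: if_distribR)
  then show "(pvar j * div_diff i k f + (if j = i then ?s else if j = k then - ?s else 0)) * (pvar i - pvar k)
     = pvar j * f - perm_poly (transpose k i) (pvar j * f)"
    using ik by (auto simp: perm_poly_mult algebra_simps)
qed

text \<open>Conjugation by \<sigma> carries the transposition of \<open>k\<close> and
  \<open>i\<close> to that of \<open>\<sigma> k\<close> and \<open>\<sigma> i\<close>; applying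
  \<sigma> to the equation defining the quotient gives the claim.\<close>

lemma perm_poly_div_diff:
  assumes "bij \<sigma>"
  shows "perm_poly \<sigma> (div_diff i k f) = div_diff (\<sigma> i) (\<sigma> k) (perm_poly \<sigma> f)"
proof (rule div_diff_eqI[symmetric])
  show "\<sigma> i \<noteq> \<sigma> k" using ik assms by (simp add: bij_is_inj inj_eq)
  have "perm_poly \<sigma> (div_diff i k f) * (pvar (\<sigma> i) - pvar (\<sigma> k))
      = perm_poly \<sigma> (div_diff i k f * (pvar i - pvar k))"
    by (simp add: assms perm_poly_mult perm_poly_diff)
  also have "\<dots> = perm_poly \<sigma> f - perm_poly \<sigma> (perm_poly (transpose k i) f)"
    by (simp add: div_diff_eq[OF ik] perm_poly_diff assms)
  also have "\<sigma> \<circ> transpose k i = transpose (\<sigma> k) (\<sigma> i) \<circ> \<sigma>"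
    using assms by (auto simp: fun_eq_iff transpose_def bij_is_inj inj_eq)
  then have "perm_poly \<sigma> (perm_poly (transpose k i) f)
      = perm_poly (transpose (\<sigma> k) (\<sigma> i)) (perm_poly \<sigma> f)"
    by (simp add: perm_poly_comp assms)
  finally show "perm_poly \<sigma> (div_diff i k f) * (pvar (\<sigma> i) - pvar (\<sigma> k))
      = perm_poly \<sigma> f - perm_poly (transpose (\<sigma> k) (\<sigma> i)) (perm_poly \<sigma> f)" .
qed

end

section \<open>Polynomials with vector coefficients\<close>

definition poly_linear :: "(cpoly \<Rightarrow> cpoly) \<Rightarrow> bool" where
  "poly_linear A \<longleftrightarrow> (\<forall>f g. A (f + g) = A f + A g) \<and>
     (\<forall>c f. A (Poly_Mapping.single 0 c * f) = Poly_Mapping.single 0 c * A f)"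

lemma poly_linear_perm [simp]: "bij \<sigma> \<Longrightarrow> poly_linear (perm_poly \<sigma>)"
  by (simp add: poly_linear_def perm_poly_add perm_poly_mult)

lemma poly_linear_times [simp]: "poly_linear ((*) p)"
  by (simp add: poly_linear_def distrib_left mult.left_commute)

lemma poly_linear_div_diff [simp]: "i \<noteq> k \<Longrightarrow> poly_linear (div_diff i k)"
  by (simp add: poly_linear_def div_diff_add div_diff_scale)

locale coeff_module = Modules.module s
  for s :: "complex \<Rightarrow> 'v::ab_group_add \<Rightarrow> 'v"
begin

text \<open>\<open>tn\<close> and \<open>ps\<close> become \<open>ptensor\<close> and
  \<open>pscale\<close> when \<open>s\<close> is \<open>vscale n act\<close>. An arbitrary scalar
  action keeps the calculus of operators independent of the presented algebras.\<close>

definition tn :: "cpoly \<Rightarrow> 'v \<Rightarrow> (nat \<Rightarrow>\<^sub>0 nat) \<Rightarrow>\<^sub>0 'v" where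
  "tn f v = Poly_Mapping.map (\<lambda>c. s c v) f"

definition ps :: "complex \<Rightarrow> ((nat \<Rightarrow>\<^sub>0 nat) \<Rightarrow>\<^sub>0 'v) \<Rightarrow> (nat \<Rightarrow>\<^sub>0 nat) \<Rightarrow>\<^sub>0 'v" where
  "ps c = Poly_Mapping.map (s c)"

text \<open>The operator \<open>A \<otimes> B\<close>, prescribed on monomial tensors. It has the
  expected value on all pure tensors when both factors are linear, see
  \<open>lin_tn\<close>.\<close>

definition lin :: "(cpoly \<Rightarrow> cpoly) \<Rightarrow> ('v \<Rightarrow> 'v) \<Rightarrow> ((nat \<Rightarrow>\<^sub>0 nat) \<Rightarrow>\<^sub>0 'v) \<Rightarrow> (nat \<Rightarrow>\<^sub>0 nat) \<Rightarrow>\<^sub>0 'v" where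
  "lin A B p = pm_sum (\<lambda>m v. tn (A (Poly_Mapping.single m 1)) (B v)) p"

lemma lookup_tn [simp]: "Poly_Mapping.lookup (tn f v) m = s (Poly_Mapping.lookup f m) v"
  by (simp add: tn_def Poly_Mapping.map.rep_eq when_def)

lemma lookup_ps [simp]: "Poly_Mapping.lookup (ps c p) m = s c (Poly_Mapping.lookup p m)"
  by (simp add: ps_def Poly_Mapping.map.rep_eq when_def)

lemma lookup_const_mult:
  "Poly_Mapping.lookup (Poly_Mapping.single 0 c * f) m = c * Poly_Mapping.lookup f m" for f :: cpoly
  by (simp add: Poly_Mapping.map.rep_eq when_def flip: mult_map_scale_conv_mult)

lemma tn_add_left: "tn (f + g) v = tn f v + tn g v"
  by (rule poly_mapping_eqI) (simp add: lookup_add scale_left_distrib)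

lemma tn_add_right: "tn f (v + w) = tn f v + tn f w"
  by (rule poly_mapping_eqI) (simp add: lookup_add scale_right_distrib)

lemma tn_zero [simp]: "tn f 0 = 0" "tn 0 v = 0"
  by (auto intro!: poly_mapping_eqI)

lemma tn_minus: "tn (- f) v = - tn f v" "tn f (- v) = - tn f v"
  by (auto intro!: poly_mapping_eqI)

lemma tn_scale: "tn (Poly_Mapping.single 0 c * f) v = ps c (tn f v)" "tn f (s c v) = ps c (tn f v)"
  by (auto intro!: poly_mapping_eqI simp: lookup_const_mult) (simp add: mult.commute)

lemma tn_single: "tn (Poly_Mapping.single m c) v = Poly_Mapping.single m (s c v)"
  by (rule poly_mapping_eqI) (simp add: lookup_single when_def)

text \<open>The embedding of \<open>V\<close> as constant polynomials makes identities in
  \<open>V\<close> testable in the polynomial module; this later gives the single-valuedness of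
  \<open>xi_ext_graph\<close>.\<close>

lemma tn_one_inject: "tn 1 v = tn 1 w \<Longrightarrow> v = w"
  using tn_single[of 0 1] by (simp add: inj_eq[OF inj_single])

lemma ps_module: "Modules.module ps"
  by unfold_locales
    (auto intro!: poly_mapping_eqI simp: lookup_add scale_left_distrib scale_right_distrib)

lemma tensor_induct [case_names pure add]:
  assumes "\<And>f v. P (tn f v)" "\<And>p q. P p \<Longrightarrow> P q \<Longrightarrow> P (p + q)"
  shows "P p"
proof (induction p rule: poly_mapping_single_induct)
  case zero
  show ?case using assms(1)[of 0 0] by simp
next
  case (single k c)
  show ?case using assms(1)[of "Poly_Mapping.single k 1" c] by (simp add: tn_single)
qed (rule assms)

definition vlin :: "('v \<Rightarrow> 'v) \<Rightarrow> bool" where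
  "vlin B \<longleftrightarrow> (\<forall>v w. B (v + w) = B v + B w) \<and> (\<forall>c v. B (s c v) = s c (B v))"

lemma vlin_id [simp]: "vlin id" by (simp add: vlin_def)

lemma lin_add: "vlin B \<Longrightarrow> lin A B (p + q) = lin A B p + lin A B q"
  unfolding lin_def by (rule pm_sum_add) (simp add: additive_def vlin_def tn_add_right)

lemma lin_tn [simp]:
  assumes A: "poly_linear A" and B: "vlin B"
  shows "lin A B (tn f v) = tn (A f) (B v)"
proof (induction f rule: poly_mapping_single_induct)
  case zero
  have "A 0 = 0" using A unfolding poly_linear_def by (metis add_cancel_right_left)
  then show ?case by (simp add: lin_def)
next
  case (single m c)
  have B0: "B 0 = 0" using B unfolding vlin_def by (metis add_cancel_right_left)
  have "A (Poly_Mapping.single m c) = Poly_Mapping.single 0 c * A (Poly_Mapping.single m 1)"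
    using A by (metis poly_linear_def mult_single add_0 mult.right_neutral)
  then show ?case
    using B B0 by (simp add: tn_single lin_def pm_sum_single vlin_def tn_scale)
next
  case (add f g)
  then show ?case using A B by (simp add: tn_add_left lin_add poly_linear_def)
qed

lemma lin_scale:
  assumes A: "poly_linear A" and B: "vlin B"
  shows "lin A B (ps c p) = ps c (lin A B p)"
proof -
  interpret W: Modules.module ps by (rule ps_module)
  show ?thesis
    by (induction p rule: tensor_induct)
      (use B in \<open>auto simp: A lin_add W.scale_right_distrib vlin_def simp flip: tn_scale(2)\<close>)
qed

end

section \<open>The elements \<open>[i,j]\<close>\<close>

lemma br_less_Suc [simp]: "br_less i (Suc i) = t_gen i"
  by (simp add: br_less_def)

text \<open>The recursive form of \<open>[i,j]\<close>: raising the upper index conjugates by one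
  generator and changes the sign. The inductions on \<open>[i,j]\<close> below rest on it.\<close>

lemma br_less_step:
  assumes "i < j"
  shows "br_less i (Suc j) = - (t_gen j * br_less i j * t_gen j)"
proof -
  have "Suc j - i - 1 = Suc (j - i - 1)" using assms by simp
  then show ?thesis
    using assms by (cases "even (j - i - 1)") (simp_all add: br_less_def mult.assoc)
qed

lemma fcar_br_less: "i < j \<Longrightarrow> 1 \<le> i \<Longrightarrow> j \<le> n \<Longrightarrow> br_less i j \<in> fcar (spin_gens n)"
  unfolding br_less_def
  by (intro fcar_mult fcar_prod_list fcar_power) (auto simp: spin_gens_def)

lemma fcar_br: "i \<in> {1..n} \<Longrightarrow> j \<in> {1..n} \<Longrightarrow> i \<noteq> j \<Longrightarrow> br i j \<in> fcar (spin_gens n)"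
  using fcar_br_less[of i j n] fcar_br_less[of j i n] by (auto simp: br_def)

lemma br_swap: "i \<noteq> j \<Longrightarrow> br j i = - br i j"
  by (auto simp: br_def)

text \<open>Distant generators are required to anticommute; for involutions this is the relation
  \<open>(t_i t_j)^2 = -1\<close>. Linearity is asked of \<open>\<tau> a\<close> for every index,
  also outside the range, so that the family defines a \<open>free_rep\<close>.\<close>

locale spin_module = coeff_module s
  for s :: "complex \<Rightarrow> 'v::ab_group_add \<Rightarrow> 'v" +
  fixes n :: nat and \<tau> :: "nat \<Rightarrow> 'v \<Rightarrow> 'v"
  assumes tau_vlin: "vlin (\<tau> a)"
    and tau_sq: "a \<in> {1..<n} \<Longrightarrow> \<tau> a (\<tau> a v) = v"
    and tau_braid: "a \<in> {1..<n} \<Longrightarrow> Suc a \<in> {1..<n} \<Longrightarrow>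
      \<tau> a (\<tau> (Suc a) (\<tau> a v)) = \<tau> (Suc a) (\<tau> a (\<tau> (Suc a) v))"
    and tau_far: "a \<in> {1..<n} \<Longrightarrow> b \<in> {1..<n} \<Longrightarrow> Suc a < b \<Longrightarrow> \<tau> a (\<tau> b v) = - \<tau> b (\<tau> a v)"
begin

lemma additive_tau: "additive (\<tau> a)"
  using tau_vlin[of a] by (simp add: additive_def vlin_def)

lemmas tau_minus [simp] = additive.minus[OF additive_tau]

definition tau_gen :: "spin_gen \<Rightarrow> 'v \<Rightarrow> 'v" where
  "tau_gen g = (case g of GenT a \<Rightarrow> \<tau> a | _ \<Rightarrow> (\<lambda>_. 0))"

lemma tau_gen_T [simp]: "tau_gen (GenT a) = \<tau> a"
  by (simp add: tau_gen_def)

sublocale V: free_rep s tau_gen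
  using tau_vlin by unfold_locales (auto simp: tau_gen_def vlin_def split: spin_gen.split)

lemma vlin_ev [simp]: "vlin (V.ev p)"
  by (simp add: vlin_def V.ev_scale)

lemma ev_minus [simp]: "V.ev p (- x) = - V.ev p x"
  by (rule additive.minus) (simp add: additive_def)

lemma ev_br_less_step: "i < j \<Longrightarrow> V.ev (br_less i (Suc j)) x = - \<tau> j (V.ev (br_less i j) (\<tau> j x))"
  by (simp add: br_less_step)

section \<open>Conjugation of \<open>[i,j]\<close> by the generators\<close>

lemma tau_far': "a \<in> {1..<n} \<Longrightarrow> b \<in> {1..<n} \<Longrightarrow> Suc b < a \<Longrightarrow> \<tau> a (\<tau> b v) = - \<tau> b (\<tau> a v)"
  using tau_far[of b a v] by simp

text \<open>All letters of \<open>[i,j]\<close> are at distance at least two from \<open>a\<close>.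
  Each of them contributes a sign, and their number is odd.\<close>

lemma tau_br_above:
  assumes "1 \<le> i" "i < j" "j < a" "a < n"
  shows "\<tau> a (V.ev (br_less i j) x) = - V.ev (br_less i j) (\<tau> a x)"
  using assms(2)[THEN Suc_leI] assms(3)
proof (induction j arbitrary: x rule: dec_induct)
  case base
  then show ?case using assms tau_far'[of a i] by simp
next
  case (step j)
  have *: "\<tau> a (\<tau> j y) = - \<tau> j (\<tau> a y)" for y
    using tau_far'[of a j] step assms by simp
  show ?case using step by (simp add: ev_br_less_step *)
qed

lemma tau_br_below:
  assumes "1 \<le> a" "Suc a < i" "i < j" "j \<le> n"
  shows "\<tau> a (V.ev (br_less i j) x) = - V.ev (br_less i j) (\<tau> a x)"
  using assms(3)[THEN Suc_leI] assms(4)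
proof (induction j arbitrary: x rule: dec_induct)
  case base
  then show ?case using assms tau_far[of a i] by simp
next
  case (step j)
  have *: "\<tau> a (\<tau> j y) = - \<tau> j (\<tau> a y)" for y
    using tau_far[of a j] step assms by simp
  show ?case using step by (simp add: ev_br_less_step *)
qed

text \<open>In the base case \<open>[i,a+2]\<close> is \<open>t_(a+1) t_a [i,a] t_a t_(a+1)\<close>.
  A braid move turns \<open>t_a\<close> into \<open>t_(a+1)\<close> in front of
  \<open>[i,a]\<close>, which it passes with a sign, and a second braid move turns it back.\<close>

lemma tau_br_inside:
  assumes "1 \<le> i" "i < a" "Suc a < j" "j \<le> n"
  shows "\<tau> a (V.ev (br_less i j) x) = - V.ev (br_less i j) (\<tau> a x)"
  using assms(3)[THEN Suc_leI] assms(4)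
proof (induction j arbitrary: x rule: dec_induct)
  case base
  let ?b = "V.ev (br_less i a)"
  have br: "V.ev (br_less i (Suc (Suc a))) x = \<tau> (Suc a) (\<tau> a (?b (\<tau> a (\<tau> (Suc a) x))))" for x
    using assms by (simp add: ev_br_less_step)
  have brd: "\<tau> a (\<tau> (Suc a) (\<tau> a y)) = \<tau> (Suc a) (\<tau> a (\<tau> (Suc a) y))" for y
    using tau_braid base assms by simp
  have ab: "\<tau> (Suc a) (?b y) = - ?b (\<tau> (Suc a) y)" for y
    using base assms by (intro tau_br_above) auto
  show ?case by (simp add: br brd ab)
next
  case (step j)
  have *: "\<tau> a (\<tau> j y) = - \<tau> j (\<tau> a y)" for y
    using tau_far[of a j] step assms by simp
  show ?case using step assms by (simp add: ev_br_less_step *)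
qed

text \<open>The base case \<open>[a,a+2] = - t_(a+1) t_a t_(a+1)\<close> is the braid relation
  combined with \<open>t_a^2 = 1\<close>; further letters are distant from \<open>a\<close> and
  contribute pairs of signs.\<close>

lemma tau_br_lower:
  assumes "1 \<le> a" "Suc a < j" "j \<le> n"
  shows "\<tau> a (V.ev (br_less (Suc a) j) x) = - V.ev (br_less a j) (\<tau> a x)"
  using assms(2)[THEN Suc_leI] assms(3)
proof (induction j arbitrary: x rule: dec_induct)
  case base
  then show ?case using assms tau_braid[of a] tau_sq[of a]
    by (simp add: ev_br_less_step) (metis)
next
  case (step j)
  have *: "\<tau> a (\<tau> j y) = - \<tau> j (\<tau> a y)" for y
    using tau_far[of a j] step assms by simp
  show ?case using step by (simp add: ev_br_less_step *)
qed

lemma tau_br_raise: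
  assumes "1 \<le> a" "Suc a < j" "j \<le> n"
  shows "\<tau> a (V.ev (br_less a j) x) = - V.ev (br_less (Suc a) j) (\<tau> a x)"
proof -
  have sq: "\<tau> a (\<tau> a y) = y" for y using tau_sq[of a] assms by simp
  have "\<tau> a (\<tau> a (V.ev (br_less (Suc a) j) (\<tau> a x))) = - \<tau> a (V.ev (br_less a j) x)"
    using tau_br_lower[OF assms, of "\<tau> a x"] by (simp add: sq)
  then show ?thesis by (simp add: sq)
qed

text \<open>The cases are the positions of \<open>a\<close> relative to \<open>i\<close> and
  \<open>j\<close>. The transposition reverses the order of the pair only for \<open>a = i\<close>,
  \<open>j = i + 1\<close>, where \<open>[j,i] = -[i,j]\<close> supplies the sign;
  \<open>a = j\<close> and \<open>a + 1 = j\<close> are the recursion of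
  \<open>[i,j]\<close>.\<close>

lemma tau_br_less:
  assumes a: "a \<in> {1..<n}" and ij: "1 \<le> i" "i < j" "j \<le> n"
  shows "\<tau> a (V.ev (br_less i j) x) =
    - V.ev (br (transpose a (Suc a) i) (transpose a (Suc a) j)) (\<tau> a x)"
proof -
  have sq: "\<tau> a (\<tau> a y) = y" for y using tau_sq a by simp
  consider "Suc a < i" | "Suc a = i" | "a = i" "j = Suc i" | "a = i" "Suc i < j"
    | "i < a" "Suc a < j" | "i < a" "Suc a = j" | "a = j" | "j < a"
    using ij by linarith
  then show ?thesis
  proof cases
    case 1
    then show ?thesis using tau_br_below[of a i j x] a ij by (simp add: br_def transpose_def)
  next
    case 2
    then show ?thesis using tau_br_lower[of a j x] a ij by (auto simp: br_def transpose_def)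
  next
    case 3
    then show ?thesis using a ij by (simp add: br_def sq)
  next
    case 4
    then show ?thesis using tau_br_raise[of a j x] a ij by (auto simp: br_def transpose_def)
  next
    case 5
    then show ?thesis using tau_br_inside[of i a j x] a ij by (simp add: br_def transpose_def)
  next
    case 6
    then show ?thesis using a ij by (auto simp: br_def transpose_def ev_br_less_step sq)
  next
    case 7
    then show ?thesis using a ij sq by (auto simp: br_def transpose_def ev_br_less_step)
  next
    case 8
    then show ?thesis using tau_br_above[of i j a x] a ij by (simp add: br_def transpose_def)
  qed
qed

lemma tau_br:
  assumes a: "a \<in> {1..<n}" and ij: "i \<in> {1..n}" "j \<in> {1..n}" "i \<noteq> j"
  shows "\<tau> a (V.ev (br i j) x) =
    - V.ev (br (transpose a (Suc a) i) (transpose a (Suc a) j)) (\<tau> a x)"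
proof (cases "i < j")
  case True
  then show ?thesis using tau_br_less[OF a, of i j] ij by (simp add: br_def[of i j])
next
  case False
  have ne: "transpose a (Suc a) j \<noteq> transpose a (Suc a) i" using ij by (auto simp: transpose_eq_iff)
  show ?thesis using False tau_br_less[OF a, of j i] ij
    by (simp add: br_def[of i j] br_swap[OF ne])
qed

end

section \<open>Dunkl operators\<close>

locale dunkl = spin_module s n \<tau>
  for s :: "complex \<Rightarrow> 'v::ab_group_add \<Rightarrow> 'v" and n and \<tau> +
  fixes u :: complex
begin

definition T :: "nat \<Rightarrow> ((nat \<Rightarrow>\<^sub>0 nat) \<Rightarrow>\<^sub>0 'v) \<Rightarrow> (nat \<Rightarrow>\<^sub>0 nat) \<Rightarrow>\<^sub>0 'v" where
  "T a = lin (perm_poly (transpose a (Suc a))) (\<tau> a)"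

definition Y :: "nat \<Rightarrow> ((nat \<Rightarrow>\<^sub>0 nat) \<Rightarrow>\<^sub>0 'v) \<Rightarrow> (nat \<Rightarrow>\<^sub>0 nat) \<Rightarrow>\<^sub>0 'v" where
  "Y j = lin ((*) (pvar j)) id"

text \<open>The Dunkl operator of the theorem, extended from pure tensors to all vector-valued
  polynomials.\<close>

definition D :: "nat \<Rightarrow> ((nat \<Rightarrow>\<^sub>0 nat) \<Rightarrow>\<^sub>0 'v) \<Rightarrow> (nat \<Rightarrow>\<^sub>0 nat) \<Rightarrow>\<^sub>0 'v" where
  "D i p = ps u (\<Sum>k\<in>{1..n} - {i}. lin (div_diff i k) (V.ev (br k i)) p)"

definition op :: "spin_gen \<Rightarrow> ((nat \<Rightarrow>\<^sub>0 nat) \<Rightarrow>\<^sub>0 'v) \<Rightarrow> (nat \<Rightarrow>\<^sub>0 nat) \<Rightarrow>\<^sub>0 'v" where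
  "op g = (case g of GenT a \<Rightarrow> T a | GenY j \<Rightarrow> Y j | GenXi i \<Rightarrow> D i)"

lemma op_simps [simp]: "op (GenT a) = T a" "op (GenY j) = Y j" "op (GenXi i) = D i"
  by (simp_all add: op_def)

lemma T_tn [simp]: "T a (tn f v) = tn (perm_poly (transpose a (Suc a)) f) (\<tau> a v)"
  by (simp add: T_def tau_vlin)

lemma Y_tn [simp]: "Y j (tn f v) = tn (pvar j * f) v"
  by (simp add: Y_def)

lemma D_tn: "D i (tn f v) = ps u (\<Sum>k\<in>{1..n} - {i}. tn (div_diff i k f) (V.ev (br k i) v))"
  unfolding D_def by (intro arg_cong[where f = "ps u"] sum.cong) auto

sublocale P: Modules.module ps
  by (rule ps_module)

sublocale W: free_rep ps op
proof unfold_locales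
  fix g c x y
  show "op g (x + y) = op g x + op g y"
    by (cases g) (simp_all add: T_def Y_def D_def tau_vlin lin_add sum.distrib P.scale_right_distrib)
  show "op g (ps c x) = ps c (op g x)"
    by (cases g) (simp_all add: T_def Y_def D_def tau_vlin lin_scale P.scale_sum_right mult.commute)
qed

lemma additive_op:
  "additive (T a)" "additive (Y j)" "additive (D i)" "additive (W.ev p)" "additive (ps c)"
  using W.rho_add[of "GenT a"] W.rho_add[of "GenY j"] W.rho_add[of "GenXi i"]
  by (simp_all add: additive_def P.scale_right_distrib)

lemmas op_zero [simp] = additive_op[THEN additive.zero]
lemmas op_add [simp] = additive_op[THEN additive.add]
lemmas op_minus [simp] = additive_op[THEN additive.minus]
lemmas op_diff [simp] = additive_op[THEN additive.diff]
lemmas op_sum [simp] = additive_op[THEN additive.sum]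

lemma op_scale [simp]: "T a (ps c p) = ps c (T a p)" "Y j (ps c p) = ps c (Y j p)"
  "D i (ps c p) = ps c (D i p)"
  using W.rho_scale[of "GenT a"] W.rho_scale[of "GenY j"] W.rho_scale[of "GenXi i"] by simp_all

section \<open>Relations between \<open>[i,j]\<close>, the variables and the Dunkl operators\<close>

lemma W_ev_br_less_step:
  "i < j \<Longrightarrow> W.ev (br_less i (Suc j)) x = - T j (W.ev (br_less i j) (T j x))"
  by (simp add: br_less_step)

text \<open>\<open>[i,j]\<close> acts as \<open>s_ij \<otimes> [i,j]\<close>: conjugating
  \<open>s_ij\<close> by \<open>s_j\<close> gives the transposition of \<open>i\<close> and
  \<open>j + 1\<close>, and the signs of the recursion agree on both sides.\<close>

lemma W_br_less_tn:
  assumes "i < j"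
  shows "W.ev (br_less i j) (tn f v) = tn (perm_poly (transpose i j) f) (V.ev (br_less i j) v)"
  using assms[THEN Suc_leI]
proof (induction j arbitrary: f v rule: dec_induct)
  case base
  show ?case by simp
next
  case (step j)
  have "transpose j (Suc j) \<circ> transpose i j \<circ> transpose j (Suc j) = transpose i (Suc j)"
    using step by (auto simp: fun_eq_iff transpose_def)
  with step show ?case
    by (simp add: W_ev_br_less_step ev_br_less_step perm_poly_comp bij_comp tn_minus comp_assoc)
qed

lemma W_br_tn:
  assumes "i \<noteq> j"
  shows "W.ev (br i j) (tn f v) = tn (perm_poly (transpose i j) f) (V.ev (br i j) v)"
  using assms W_br_less_tn[of i j] W_br_less_tn[of j i]
  by (auto simp: br_def tn_minus transpose_commute)

text \<open>Divided differences are equivariant without a sign and the brackets with a sign.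
  Reindexing the sum by \<open>s_a\<close> moves the excluded index from \<open>i\<close> to
  \<open>s_a i\<close>.\<close>

lemma T_D:
  assumes a: "a \<in> {1..<n}" and i: "i \<in> {1..n}"
  shows "T a (D i p) = - D (transpose a (Suc a) i) (T a p)"
proof (induction p rule: tensor_induct)
  case (pure f v)
  let ?s = "transpose a (Suc a)"
  have bij: "bij_betw ?s ({1..n} - {i}) ({1..n} - {?s i})"
    using a i by (intro bij_betw_DiffI) (auto simp: transpose_def)
  have "T a (D i (tn f v))
    = ps u (\<Sum>k\<in>{1..n} - {i}. tn (perm_poly ?s (div_diff i k f)) (\<tau> a (V.ev (br k i) v)))"
    by (simp add: D_tn)
  also have "(\<Sum>k\<in>{1..n} - {i}. tn (perm_poly ?s (div_diff i k f)) (\<tau> a (V.ev (br k i) v)))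
    = (\<Sum>k\<in>{1..n} - {i}. - tn (div_diff (?s i) (?s k) (perm_poly ?s f)) (V.ev (br (?s k) (?s i)) (\<tau> a v)))"
    using i by (intro sum.cong) (auto simp: perm_poly_div_diff tau_br[OF a] tn_minus)
  also have "\<dots> = - (\<Sum>k\<in>{1..n} - {?s i}. tn (div_diff (?s i) k (perm_poly ?s f)) (V.ev (br k (?s i)) (\<tau> a v)))"
    unfolding sum_negf by (rule arg_cong[OF sum.reindex_bij_betw[OF bij]])
  finally show ?case by (simp add: D_tn)
qed simp

text \<open>In the recursion the Dunkl operator passes \<open>t_l\<close>, \<open>[k,l]\<close> and
  \<open>t_l\<close> again; the three signs multiply to one, and the three transpositions compose to
  that of \<open>k\<close> and \<open>l + 1\<close>.\<close>

lemma br_less_D: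
  assumes "1 \<le> k" "k < l" "l \<le> n" "i \<in> {1..n}"
  shows "W.ev (br_less k l) (D i p) = - D (transpose k l i) (W.ev (br_less k l) p)"
  using assms(2)[THEN Suc_leI] assms(1,3,4)
proof (induction l arbitrary: p i rule: dec_induct)
  case base
  then show ?case by (simp add: T_D)
next
  case (step l)
  let ?s = "transpose l (Suc l)"
  have i: "?s i \<in> {1..n}" "transpose k l (?s i) \<in> {1..n}"
    using step by (auto simp: transpose_def)
  have "?s (transpose k l (?s i)) = transpose k (Suc l) i"
    using step by (auto simp: transpose_def)
  with step i show ?case
    by (simp add: W_ev_br_less_step T_D del: transpose_apply_first)
qed

lemma br_D:
  assumes "k \<in> {1..n}" "l \<in> {1..n}" "k \<noteq> l" "i \<in> {1..n}"
  shows "W.ev (br k l) (D i p) = - D (transpose k l i) (W.ev (br k l) p)"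
  using assms br_less_D[of k l i p] br_less_D[of l k i p]
  by (cases "k < l") (auto simp: br_def transpose_commute)

text \<open>By the twisted Leibniz rule only the summand \<open>k = j\<close> acquires an extra
  term, which is the action of \<open>[i,j]\<close> because \<open>[j,i] = -[i,j]\<close>. For
  \<open>j\<close> outside the index range that summand is absent.\<close>

lemma D_Y_other:
  assumes "i \<in> {1..n}" "i \<noteq> j"
  shows "D i (Y j p) = Y j (D i p) + (if j \<in> {1..n} then ps u (W.ev (br i j) p) else 0)"
proof (induction p rule: tensor_induct)
  case (pure f v)
  have "tn (div_diff i k (pvar j * f)) (V.ev (br k i) v)
      = tn (pvar j * div_diff i k f) (V.ev (br k i) v) + (if k = j then W.ev (br i j) (tn f v) else 0)"
    if "k \<noteq> i" for k
    using that assms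
    by (auto simp: div_diff_pvar tn_add_left tn_minus W_br_tn br_swap[of j i] transpose_commute)
  then have "(\<Sum>k\<in>{1..n} - {i}. tn (div_diff i k (pvar j * f)) (V.ev (br k i) v))
    = (\<Sum>k\<in>{1..n} - {i}. tn (pvar j * div_diff i k f) (V.ev (br k i) v))
      + (\<Sum>k\<in>{1..n} - {i}. if k = j then W.ev (br i j) (tn f v) else 0)"
    by (simp add: sum.distrib)
  also have "(\<Sum>k\<in>{1..n} - {i}. if k = j then W.ev (br i j) (tn f v) else 0)
    = (if j \<in> {1..n} then W.ev (br i j) (tn f v) else 0)"
    using assms by (subst sum.delta) auto
  finally show ?case by (simp add: D_tn P.scale_right_distrib)
qed (auto simp: P.scale_right_distrib)

text \<open>Here every summand of the Dunkl operator acquires an extra term, namely the action of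
  \<open>-[i,k]\<close>.\<close>

lemma D_Y_same:
  assumes "i \<in> {1..n}"
  shows "D i (Y i p) = Y i (D i p) - ps u (\<Sum>k\<in>{1..n} - {i}. W.ev (br i k) p)"
proof (induction p rule: tensor_induct)
  case (pure f v)
  have "tn (div_diff i k (pvar i * f)) (V.ev (br k i) v)
      = tn (pvar i * div_diff i k f) (V.ev (br k i) v) - W.ev (br i k) (tn f v)"
    if "k \<noteq> i" for k
    using that
    by (auto simp: div_diff_pvar tn_add_left tn_minus W_br_tn br_swap[of k i] transpose_commute)
  then have "(\<Sum>k\<in>{1..n} - {i}. tn (div_diff i k (pvar i * f)) (V.ev (br k i) v))
    = (\<Sum>k\<in>{1..n} - {i}. tn (pvar i * div_diff i k f) (V.ev (br k i) v))
      - (\<Sum>k\<in>{1..n} - {i}. W.ev (br i k) (tn f v))"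
    by (simp add: sum_subtractf)
  then show ?case by (simp add: D_tn P.scale_right_diff_distrib)
qed (simp add: sum.distrib P.scale_right_distrib)

lemma D_tn_const: "D i (tn (Poly_Mapping.single 0 c) v) = 0"
proof -
  have "div_diff i k (Poly_Mapping.single 0 c) = 0" if "i \<noteq> k" for k
    using div_diff_scale[OF that, of c 1] div_diff_one[OF that] by simp
  then show ?thesis by (simp add: D_tn)
qed

text \<open>For \<open>k\<close> distinct from \<open>i\<close> and \<open>j\<close> the corrections
  cancel in pairs, since \<open>[i,k]\<close> anticommutes with \<open>D j\<close> and
  \<open>[j,k]\<close> with \<open>D i\<close>. The substantial case is \<open>k = i\<close>; the
  case \<open>k = j\<close> is symmetric.\<close>

lemma D_anticomm_Y:
  assumes i: "i \<in> {1..n}" and j: "j \<in> {1..n}" and ij: "i \<noteq> j"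
  shows "D i (D j (Y k p)) + D j (D i (Y k p)) = Y k (D i (D j p) + D j (D i p))"
proof -
  have same: "D i (D j (Y i p)) + D j (D i (Y i p)) = Y i (D i (D j p) + D j (D i p))"
    if i: "i \<in> {1..n}" and j: "j \<in> {1..n}" and ij: "i \<noteq> j" for i j
  proof -
    let ?S = "\<Sum>l\<in>{1..n} - {i}. W.ev (br i l) (D j p)"
    let ?S' = "\<Sum>l\<in>{1..n} - {i}. D j (W.ev (br i l) p)"
    \<comment> \<open>For \<open>l\<close> different from \<open>j\<close> the transposition of
      \<open>i\<close> and \<open>l\<close> fixes \<open>j\<close>, so \<open>[i,l]\<close>
      anticommutes with \<open>D j\<close> and its two terms cancel. What survives at
      \<open>l = j\<close> matches the corrections from moving \<open>y_i\<close> past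
      \<open>D j\<close>.\<close>
    have "?S + ?S' = (\<Sum>l\<in>{1..n} - {i}. W.ev (br i l) (D j p) + D j (W.ev (br i l) p))"
      by (simp add: sum.distrib)
    also have "\<dots> = W.ev (br i j) (D j p) + D j (W.ev (br i j) p)
      + (\<Sum>l\<in>{1..n} - {i} - {j}. W.ev (br i l) (D j p) + D j (W.ev (br i l) p))"
      using j ij by (intro sum.remove) auto
    also have "(\<Sum>l\<in>{1..n} - {i} - {j}. W.ev (br i l) (D j p) + D j (W.ev (br i l) p)) = 0"
      using i j ij by (intro sum.neutral) (auto simp: br_D)
    finally have S: "?S + ?S' = D j (W.ev (br i j) p) - D i (W.ev (br i j) p)"
      using i j ij by (simp add: br_D)
    have "D i (D j (Y i p)) = Y i (D i (D j p)) - ps u ?S - ps u (D i (W.ev (br i j) p))"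
      using i j ij by (simp only: D_Y_other D_Y_same op_add op_scale if_True W.ev_uminus op_minus br_swap[of i j])
        (simp add: br_swap[of i j])
    moreover have "D j (D i (Y i p)) = Y i (D j (D i p)) + ps u (D j (W.ev (br i j) p)) - ps u ?S'"
      using i j ij by (simp only: D_Y_other D_Y_same op_diff op_scale if_True W.ev_uminus op_minus op_sum
          br_swap[of i j] br_D transpose_apply_first) (simp add: br_swap[of i j])
    ultimately have "D i (D j (Y i p)) + D j (D i (Y i p)) = Y i (D i (D j p) + D j (D i p))
      + ps u (D j (W.ev (br i j) p) - D i (W.ev (br i j) p) - (?S + ?S'))"
      by (simp only: op_add op_diff) (simp only: algebra_simps)
    then show ?thesis unfolding S by simp
  qed
  consider "k = i" | "k = j" | "k \<noteq> i" "k \<noteq> j" by blast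
  then show ?thesis
  proof cases
    case 1
    then show ?thesis using same[OF i j ij] by simp
  next
    case 2
    then show ?thesis using same[OF j i] ij by (simp add: add.commute)
  next
    case 3
    then show ?thesis using i j ij by (auto simp: D_Y_other br_D algebra_simps)
  qed
qed

lemma D_anticomm:
  assumes i: "i \<in> {1..n}" and j: "j \<in> {1..n}" and ij: "i \<noteq> j"
  shows "D i (D j p) + D j (D i p) = 0"
proof (induction p rule: tensor_induct)
  case (pure f v)
  show ?case
  proof (induction f rule: cpoly_induct)
    case (const c)
    show ?case by (simp add: D_tn_const)
  next
    case (add f g)
    then show ?case by (simp add: tn_add_left algebra_simps)
  next
    case (var k f)
    then show ?case using D_anticomm_Y[OF assms, of k "tn f v"]
      by (simp del: op_add)
  qed
next
  case (add p q)
  then have "(D i (D j p) + D j (D i p)) + (D i (D j q) + D j (D i q)) = 0" by simp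
  then show ?case by (simp add: algebra_simps)
qed

section \<open>The defining relations as operator identities\<close>

lemma T_rels:
  assumes "a \<in> {1..<n}"
  shows "T a (T a p) = p"
    and "Suc a \<in> {1..<n} \<Longrightarrow> T a (T (Suc a) (T a p)) = T (Suc a) (T a (T (Suc a) p))"
    and "b \<in> {1..<n} \<Longrightarrow> Suc a < b \<Longrightarrow> T a (T b p) = - T b (T a p)"
    and "T a (Y j p) = Y (transpose a (Suc a) j) (T a p)"
proof (induction p rule: tensor_induct)
  case (pure f v)
  {
    case 1
    show ?case using assms by (simp add: perm_poly_comp tau_sq)
  next
    case 2
    have "transpose a (Suc a) \<circ> (transpose (Suc a) (Suc (Suc a)) \<circ> transpose a (Suc a))
      = transpose (Suc a) (Suc (Suc a)) \<circ> (transpose a (Suc a) \<circ> transpose (Suc a) (Suc (Suc a)))"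
      by (auto simp: fun_eq_iff transpose_def)
    with 2 show ?case using assms by (simp add: perm_poly_comp bij_comp tau_braid)
  next
    case 3
    then have "transpose a (Suc a) \<circ> transpose b (Suc b) = transpose b (Suc b) \<circ> transpose a (Suc a)"
      by (auto simp: fun_eq_iff transpose_def)
    with 3 show ?case using assms by (simp add: perm_poly_comp tau_far[of a b] tn_minus)
  next
    case 4
    show ?case by (simp add: perm_poly_mult)
  }
qed auto

lemma Y_comm: "Y i (Y j p) = Y j (Y i p)"
  by (induction p rule: tensor_induct) (simp_all add: mult.left_commute)

lemma W_ev_daha_rels:
  assumes "r \<in> daha_rels n u"
  shows "W.ev r p = 0"
proof -
  have far: "T a (T b p) = - T b (T a p)"
    if "a \<in> {1..<n}" "b \<in> {1..<n}" "a + 1 < b \<or> b + 1 < a" for a b p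
    using T_rels(3)[of a b p] T_rels(3)[of b a p] that by auto
  \<comment> \<open>Anticommuting involutions satisfy \<open>(t_a t_b)^2 = -1\<close>, the form in
    which the relation is imposed.\<close>
  have f2: "T a (T b (T a (T b p))) = - p"
    if "a \<in> {1..<n}" "b \<in> {1..<n}" "a + 1 < b \<or> b + 1 < a" for a b p
    using far[OF that, of "T b p"] far[OF that, of p] that by (simp add: far[OF that] T_rels(1))
  show ?thesis
    using assms unfolding daha_rels_def spin_rels_def
    by (auto simp: T_rels T_D Y_comm D_anticomm D_Y_other D_Y_same f2 power2_eq_square W.ev_sum
      simp flip: Suc_eq_plus1)
qed

end

section \<open>Balanced tensor products\<close>

locale tensor_product = ring A for A (structure) +
  fixes S :: "'a set" and ac :: "'a \<Rightarrow> 'v::ab_group_add \<Rightarrow> 'v"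
  assumes S_carrier: "S \<subseteq> carrier A"
begin

abbreviation "F \<equiv> tensor_free A :: (('a \<times> 'v) \<Rightarrow>\<^sub>0 int) monoid"
abbreviation "N \<equiv> tensor_null A S ac"

text \<open>Left multiplication on representatives; \<open>tensor_act\<close> is the map it induces
  on classes.\<close>

definition smul :: "'a \<Rightarrow> (('a \<times> 'v) \<Rightarrow>\<^sub>0 int) \<Rightarrow> ('a \<times> 'v) \<Rightarrow>\<^sub>0 int" where
  "smul h = frag_extend (\<lambda>(a, v). frag_of (h \<otimes> a, v))"

lemma F_simps: "mult F = (+)" "one F = 0"
  by (simp_all add: tensor_free_def free_Abelian_group_def)

lemma F_carrier: "x \<in> carrier F \<longleftrightarrow> Poly_Mapping.keys x \<subseteq> carrier A \<times> UNIV"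
  by (simp add: tensor_free_def)

lemma group_F: "group F"
  by (simp add: tensor_free_def)

lemma inv_F: "x \<in> carrier F \<Longrightarrow> inv\<^bsub>F\<^esub> x = - x"
  by (simp add: tensor_free_def inv_free_Abelian_group)

lemma F_diff: "x \<in> carrier F \<Longrightarrow> y \<in> carrier F \<Longrightarrow> x - y \<in> carrier F"
  using keys_diff[of x y] by (auto simp: F_carrier)

lemma F_frag_of [simp]: "frag_of (a, v) \<in> carrier F \<longleftrightarrow> a \<in> carrier A"
  by (simp add: F_carrier)

lemma rels_F: "tensor_rels A S ac \<subseteq> carrier F"
  using S_carrier by (auto simp: tensor_rels_def intro!: F_diff)

lemma subgroup_N: "subgroup N F"
  unfolding tensor_null_def by (rule group.generate_is_subgroup[OF group_F rels_F])

lemma N_F: "x \<in> N \<Longrightarrow> x \<in> carrier F"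
  by (rule subgroup.mem_carrier[OF subgroup_N])

lemma N_zero [simp]: "0 \<in> N"
  using subgroup.one_closed[OF subgroup_N] by (simp add: F_simps)

lemma N_add: "x \<in> N \<Longrightarrow> y \<in> N \<Longrightarrow> x + y \<in> N"
  using subgroup.m_closed[OF subgroup_N, of x y] by (simp add: F_simps)

lemma N_minus: "x \<in> N \<Longrightarrow> - x \<in> N"
  using subgroup.m_inv_closed[OF subgroup_N, of x] by (simp add: inv_F N_F)

lemma N_diff: "x \<in> N \<Longrightarrow> y \<in> N \<Longrightarrow> x - y \<in> N"
  using N_add[OF _ N_minus] by fastforce

lemma N_sum: "(\<And>k. k \<in> K \<Longrightarrow> f k \<in> N) \<Longrightarrow> sum f K \<in> N"
  by (induction K rule: infinite_finite_induct) (auto intro: N_add)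

lemma N_rels: "x \<in> tensor_rels A S ac \<Longrightarrow> x \<in> N"
  by (simp add: tensor_null_def generate.incl)

lemma N_add_left:
  "a \<in> carrier A \<Longrightarrow> b \<in> carrier A \<Longrightarrow> frag_of (a \<oplus> b, v) - frag_of (a, v) - frag_of (b, v) \<in> N"
  by (rule N_rels) (unfold tensor_rels_def, blast)

lemma N_add_right:
  "a \<in> carrier A \<Longrightarrow> frag_of (a, v + w) - frag_of (a, v) - frag_of (a, w) \<in> N"
  by (rule N_rels) (unfold tensor_rels_def, blast)

lemma N_balanced:
  "a \<in> carrier A \<Longrightarrow> c \<in> S \<Longrightarrow> frag_of (a \<otimes> c, v) - frag_of (a, ac c v) \<in> N"
  by (rule N_rels) (unfold tensor_rels_def, blast)

lemma N_zero_right: "a \<in> carrier A \<Longrightarrow> frag_of (a, 0) \<in> N"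
  using N_minus[OF N_add_right[of a 0 0]] by simp

lemma N_induct [consumes 1, case_names zero rel add minus]:
  assumes "x \<in> N" and "P 0" and rel: "\<And>x. x \<in> tensor_rels A S ac \<Longrightarrow> P x"
    and "\<And>x y. P x \<Longrightarrow> P y \<Longrightarrow> P (x + y)" and minus: "\<And>x. P x \<Longrightarrow> P (- x)"
  shows "P x"
  using assms(1) unfolding tensor_null_def
proof (induction rule: generate.induct)
  case (inv h)
  then have "inv\<^bsub>F\<^esub> h = - h" using rels_F by (auto intro: inv_F)
  with inv rel minus show ?case by simp
qed (use assms in \<open>auto simp: F_simps\<close>)

lemma in_tensor_cls: "z \<in> tensor_cls A S ac x \<longleftrightarrow> z - x \<in> N"
proof -
  have "z = (z - x) + x" by simp
  then show ?thesis by (auto simp: tensor_cls_def r_coset_def F_simps intro: bexI[of _ "z - x"])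
qed

lemma tensor_cls_iff: "tensor_cls A S ac x = tensor_cls A S ac y \<longleftrightarrow> x - y \<in> N"
proof
  assume "tensor_cls A S ac x = tensor_cls A S ac y"
  then show "x - y \<in> N" using in_tensor_cls[of x x] in_tensor_cls[of x y] by simp
next
  assume xy: "x - y \<in> N"
  have "z - x \<in> N \<longleftrightarrow> z - y \<in> N" for z
    using N_add[OF _ xy, of "z - x"] N_diff[OF _ xy, of "z - y"] by auto
  then show "tensor_cls A S ac x = tensor_cls A S ac y" by (auto simp: in_tensor_cls)
qed

lemma smul_frag_of [simp]: "smul h (frag_of (a, v)) = frag_of (h \<otimes> a, v)"
  by (simp add: smul_def)

lemma smul_add: "smul h (x + y) = smul h x + smul h y"
  by (simp add: smul_def frag_extend_add)

lemma additive_smul: "additive (smul h)"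
  by (simp add: additive_def smul_add)

lemmas smul_minus = additive.minus[OF additive_smul]
lemmas smul_diff = additive.diff[OF additive_smul]
lemmas smul_sum = additive.sum[OF additive_smul]
lemmas smul_zero [simp] = additive.zero[OF additive_smul]

text \<open>Left multiplication sends relations to relations, by distributivity and associativity in
  \<open>A\<close>. This makes the action on classes well defined.\<close>

lemma smul_N:
  assumes h: "h \<in> carrier A" and x: "x \<in> N"
  shows "smul h x \<in> N"
  using x
proof (induction rule: N_induct)
  case (rel x)
  have S: "c \<in> S \<Longrightarrow> c \<in> carrier A" for c using S_carrier by auto
  consider a b v where "a \<in> carrier A" "b \<in> carrier A"
      "x = frag_of (a \<oplus> b, v) - frag_of (a, v) - frag_of (b, v)"
    | a v w where "a \<in> carrier A" "x = frag_of (a, v + w) - frag_of (a, v) - frag_of (a, w)"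
    | a c v where "a \<in> carrier A" "c \<in> S" "x = frag_of (a \<otimes> c, v) - frag_of (a, ac c v)"
    using rel unfolding tensor_rels_def by blast
  then show ?case
  proof cases
    case (1 a b v)
    then show ?thesis using N_add_left[of "h \<otimes> a" "h \<otimes> b" v] h by (simp add: smul_diff r_distr)
  next
    case (2 a v w)
    then show ?thesis using N_add_right[of "h \<otimes> a" v w] h by (simp add: smul_diff)
  next
    case (3 a c v)
    then show ?thesis using N_balanced[of "h \<otimes> a" c v] h by (simp add: smul_diff S m_assoc)
  qed
qed (auto simp: smul_add smul_minus intro: N_add N_minus)

lemma tensor_act_cls:
  assumes "h \<in> carrier A"
  shows "tensor_act A S ac h (tensor_cls A S ac x) = tensor_cls A S ac (smul h x)"
proof -
  have "tensor_cls A S ac (smul h z) = tensor_cls A S ac (smul h x)" if "z \<in> tensor_cls A S ac x" for z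
    using smul_N[OF assms, of "z - x"] that by (simp add: in_tensor_cls tensor_cls_iff smul_diff)
  moreover have "x \<in> tensor_cls A S ac x" by (simp add: in_tensor_cls)
  ultimately show ?thesis
    unfolding tensor_act_def smul_def[symmetric] by blast
qed

end

section \<open>The induced module\<close>

lemma fcar_br_daha: "i \<in> {1..n} \<Longrightarrow> j \<in> {1..n} \<Longrightarrow> i \<noteq> j \<Longrightarrow> br i j \<in> fcar (daha_gens n)"
  by (rule fcar_mono[OF _ fcar_br]) (auto simp: daha_gens_def)

lemma mem_spin_gens [simp]: "GenT a \<in> spin_gens n \<longleftrightarrow> a \<in> {1..<n}"
  by (auto simp: spin_gens_def)

lemma mem_daha_gens [simp]:
  "GenT a \<in> daha_gens n \<longleftrightarrow> a \<in> {1..<n}"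
  "GenXi i \<in> daha_gens n \<longleftrightarrow> i \<in> {1..n}"
  "GenY i \<in> daha_gens n \<longleftrightarrow> i \<in> {1..n}"
  by (auto simp: daha_gens_def spin_gens_def)

lemma presentation_spin: "presentation (spin_gens n) (spin_rels n)"
  by unfold_locales (auto simp: spin_rels_def)

lemma presentation_daha: "presentation (daha_gens n) (daha_rels n u)"
proof
  have "spin_rels n \<subseteq> fcar (daha_gens n)" by (auto simp: spin_rels_def)
  then show "daha_rels n u \<subseteq> fcar (daha_gens n)"
    unfolding daha_rels_def
    by (auto intro!: fcar_br_daha fcar_diff fcar_add fcar_mult fcar_sum)
qed

lemma const_commute: "const c * p = p * const c"
  by (induction p rule: poly_mapping_single_induct)
    (simp_all add: const_def mult_single mult.commute distrib_left distrib_right)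

lemma const_mult: "const (c * d) = const c * const d"
  by (simp add: const_def mult_single)

lemma const_add: "const (c + d) = const c + const d"
  by (simp add: const_def single_add)

lemma const_uminus_one: "const (- 1) = - 1"
  by (simp add: const_def single_uminus)

lemma monomial_induct [consumes 1, case_names zero var]:
  fixes m :: "nat \<Rightarrow>\<^sub>0 nat"
  assumes m: "Poly_Mapping.keys m \<subseteq> J" and zero: "P 0"
    and var: "\<And>m j. Poly_Mapping.keys m \<subseteq> J \<Longrightarrow> j \<in> J \<Longrightarrow> P m \<Longrightarrow> P (Poly_Mapping.single j 1 + m)"
  shows "P m"
proof -
  \<comment> \<open>Generalised to translation by an arbitrary admissible \<open>l\<close>, so that
    the exponents of a sum of monomials can be added in succession.\<close>
  have "\<forall>l. Poly_Mapping.keys l \<subseteq> J \<longrightarrow> P l \<longrightarrow> Poly_Mapping.keys (m + l) \<subseteq> J \<and> P (m + l)"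
  proof (induction m rule: poly_mapping_single_induct)
    case (single j e)
    with m have j: "j \<in> J" by auto
    show ?case
    proof (induction e)
      case (Suc e)
      have "Poly_Mapping.single j (Suc e) + l = Poly_Mapping.single j 1 + (Poly_Mapping.single j e + l)" for l
        by (simp flip: single_add add.assoc)
      moreover have "Poly_Mapping.keys (Poly_Mapping.single j 1 + l) \<subseteq> J" if "Poly_Mapping.keys l \<subseteq> J"
        for l :: "nat \<Rightarrow>\<^sub>0 nat"
        using keys_add[of "Poly_Mapping.single j 1" l] that j by auto
      ultimately show ?case using Suc var j by (metis (no_types))
    qed simp
  next
    case (add p q)
    then show ?case by (simp add: add.assoc)
  qed simp
  from this[rule_format, of 0] zero show ?thesis by simp
qed

locale induced_module =
  fixes n :: nat and u :: complex
    and act :: "spin_gen falg set \<Rightarrow> 'v::ab_group_add \<Rightarrow> 'v"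
  assumes spin_act: "left_module (spin_alg n) act"
begin

sublocale Sp: presentation "spin_gens n" "spin_rels n"
  by (rule presentation_spin)

sublocale H: presentation "daha_gens n" "daha_rels n u"
  by (rule presentation_daha)

sublocale M: left_module "spin_alg n" act
  by (rule spin_act)

sublocale HR: ring "daha n u"
  by (rule H.ring_A)

abbreviation "vs \<equiv> vscale n act"

text \<open>The value 0 outside the index range, where \<open>act\<close> is unspecified, keeps every \<open>tau a\<close> linear.\<close>

definition tau :: "nat \<Rightarrow> 'v \<Rightarrow> 'v" where
  "tau a = (if a \<in> {1..<n} then act (spin_cls n (t_gen a)) else (\<lambda>_. 0))"

lemma act_spin_mult:
  "p \<in> fcar (spin_gens n) \<Longrightarrow> q \<in> fcar (spin_gens n) \<Longrightarrow>
    act (spin_cls n (p * q)) v = act (spin_cls n p) (act (spin_cls n q) v)"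
  by (simp add: Sp.cls_mult M.act_mult)

lemma act_spin_add:
  "p \<in> fcar (spin_gens n) \<Longrightarrow> q \<in> fcar (spin_gens n) \<Longrightarrow>
    act (spin_cls n (p + q)) v = act (spin_cls n p) v + act (spin_cls n q) v"
  by (simp add: Sp.cls_add M.act_add_left)

lemma act_spin_one: "act (spin_cls n 1) v = v"
  by (simp add: Sp.cls_one M.act_one)

lemma act_spin_right: "p \<in> fcar (spin_gens n) \<Longrightarrow>
    act (spin_cls n p) (v + w) = act (spin_cls n p) v + act (spin_cls n p) w"
  by (simp add: M.act_add_right)

lemma act_spin_rel: "p - q \<in> spin_rels n \<Longrightarrow> p \<in> fcar (spin_gens n) \<Longrightarrow> q \<in> fcar (spin_gens n) \<Longrightarrow>
    act (spin_cls n p) v = act (spin_cls n q) v"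
  by (simp add: Sp.cls_eqI)

lemma vs_module: "Modules.module vs"
proof
  fix a b :: complex and x y :: 'v
  show "vs a (x + y) = vs a x + vs a y" by (simp add: vscale_def act_spin_right)
  show "vs (a + b) x = vs a x + vs b x" by (simp add: vscale_def const_add act_spin_add)
  show "vs a (vs b x) = vs (a * b) x" by (simp add: vscale_def const_mult act_spin_mult)
  show "vs 1 x = x" by (simp add: vscale_def act_spin_one)
qed

sublocale coeff_module vs
  by (intro coeff_module.intro vs_module)

lemma act_uminus: "p \<in> fcar (spin_gens n) \<Longrightarrow> act (spin_cls n (- p)) v = - act (spin_cls n p) v"
  using act_spin_mult[of "const (-1)" p v] scale_minus_left[of 1 "act (spin_cls n p) v"]
  by (simp add: const_uminus_one vscale_def act_spin_one)

lemma tau_eq: "a \<in> {1..<n} \<Longrightarrow> tau a v = act (spin_cls n (t_gen a)) v"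
  by (simp add: tau_def)

sublocale dunkl vs n tau u
proof unfold_locales
  have "act (spin_cls n (t_gen a)) (vs c v) = vs c (act (spin_cls n (t_gen a)) v)"
    if "a \<in> {1..<n}" for a c v
    using act_spin_mult[of "t_gen a" "const c" v] act_spin_mult[of "const c" "t_gen a" v] that
    by (simp add: vscale_def const_commute)
  then show "vlin (tau a)" for a
    by (cases "a \<in> {1..<n}") (auto simp: vlin_def tau_def act_spin_right)
next
  fix a v assume a: "a \<in> {1..<n}"
  have "t_gen a * t_gen a - 1 \<in> spin_rels n" using a by (auto simp: spin_rels_def)
  from act_spin_rel[OF this, of v] show "tau a (tau a v) = v"
    using a by (simp add: tau_eq act_spin_mult act_spin_one)
next
  fix a v assume a: "a \<in> {1..<n}" "Suc a \<in> {1..<n}"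
  have "t_gen a * t_gen (Suc a) * t_gen a - t_gen (Suc a) * t_gen a * t_gen (Suc a) \<in> spin_rels n"
    using a by (auto simp: spin_rels_def)
  from act_spin_rel[OF this, of v]
  show "tau a (tau (Suc a) (tau a v)) = tau (Suc a) (tau a (tau (Suc a) v))"
    using a by (simp add: tau_eq act_spin_mult)
next
  fix a b v assume a: "a \<in> {1..<n}" "b \<in> {1..<n}" "Suc a < b"
  have sq: "tau c (tau c v) = v" if "c \<in> {1..<n}" for c v
  proof -
    have "t_gen c * t_gen c - 1 \<in> spin_rels n" using that by (auto simp: spin_rels_def)
    from act_spin_rel[OF this, of v] show ?thesis
      using that by (simp add: tau_eq act_spin_mult act_spin_one)
  qed
  \<comment> \<open>Written as a difference from \<open>-1\<close> to fit
    \<open>act_spin_rel\<close>. The resulting identity, evaluated at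
    \<open>tau b (tau a v)\<close>, loses the inner factors in pairs and becomes
    anticommutation.\<close>
  have "(t_gen a * t_gen b) ^ 2 - (- 1) \<in> spin_rels n"
    unfolding spin_rels_def
    using a by (intro UnI2 CollectI exI[of _ a] exI[of _ b]) simp
  from act_spin_rel[OF this, of w for w]
  have "tau a (tau b (tau a (tau b w))) = - w" for w
    using a by (simp add: tau_eq act_spin_mult act_spin_one act_uminus power2_eq_square)
  from this[of "tau b (tau a v)"] show "tau a (tau b v) = - tau b (tau a v)"
    using a by (simp add: sq)
qed

text \<open>Both sides are compatible with sums, products and scalars and agree on the
  generators.\<close>

lemma V_ev: "p \<in> fcar (spin_gens n) \<Longrightarrow> V.ev p v = act (spin_cls n p) v"
proof (induction p arbitrary: v rule: free_alg_induct)
  case zero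
  show ?case using act_spin_add[of 0 0 v] by simp
next
  case (const c)
  show ?case unfolding V.ev_const by (simp add: vscale_def)
next
  case (gen g)
  then show ?case by (auto simp: spin_gens_def tau_eq)
qed (simp_all add: act_spin_add act_spin_mult)

text \<open>Permutations of the variables fix the polynomial 1, so on \<open>1 \<otimes> V\<close>
  only the action on \<open>V\<close> remains.\<close>

lemma W_ev_tn_one: "p \<in> fcar (spin_gens n) \<Longrightarrow> W.ev p (tn 1 v) = tn 1 (V.ev p v)"
proof (induction p arbitrary: v rule: free_alg_induct)
  case (const c)
  show ?case by (simp add: tn_scale)
next
  case (gen g)
  moreover have "perm_poly (transpose a b) 1 = 1" for a b
    using perm_poly_const[of "transpose a b" 1] by simp
  ultimately show ?case by (auto simp: spin_gens_def)
qed (simp_all add: tn_add_right)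

subsection \<open>The action of the Hecke algebra\<close>

text \<open>The choice of representative is immaterial by \<open>Ev_cls\<close>, because the
  operators satisfy the defining relations.\<close>

definition Ev :: "spin_gen falg set \<Rightarrow> ((nat \<Rightarrow>\<^sub>0 nat) \<Rightarrow>\<^sub>0 'v) \<Rightarrow> (nat \<Rightarrow>\<^sub>0 nat) \<Rightarrow>\<^sub>0 'v" where
  "Ev a = W.ev (SOME p. p \<in> fcar (daha_gens n) \<and> daha_cls n u p = a)"

lemma Ev_cls [simp]:
  assumes p: "p \<in> fcar (daha_gens n)"
  shows "Ev (daha_cls n u p) x = W.ev p x"
proof -
  let ?q = "SOME q. q \<in> fcar (daha_gens n) \<and> daha_cls n u q = daha_cls n u p"
  have "?q \<in> fcar (daha_gens n) \<and> daha_cls n u ?q = daha_cls n u p"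
    by (rule someI[of _ p]) (use p in simp)
  then show ?thesis
    unfolding Ev_def using p W_ev_daha_rels
    by (intro W.ev_cls_cong[OF H.rels]) auto
qed

lemma carrierE: "a \<in> carrier (daha n u) \<Longrightarrow> (\<And>p. p \<in> fcar (daha_gens n) \<Longrightarrow> a = daha_cls n u p \<Longrightarrow> P) \<Longrightarrow> P"
  unfolding H.carrier_A by blast

lemma Ev_mult: "a \<in> carrier (daha n u) \<Longrightarrow> b \<in> carrier (daha n u) \<Longrightarrow>
    Ev (a \<otimes>\<^bsub>daha n u\<^esub> b) x = Ev a (Ev b x)"
  by (elim carrierE) (simp flip: H.cls_mult)

lemma Ev_add: "a \<in> carrier (daha n u) \<Longrightarrow> b \<in> carrier (daha n u) \<Longrightarrow>
    Ev (a \<oplus>\<^bsub>daha n u\<^esub> b) x = Ev a x + Ev b x"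
  by (elim carrierE) (simp flip: H.cls_add)

lemma Ev_right: "Ev a (x + y) = Ev a x + Ev a y" "Ev a (x - y) = Ev a x - Ev a y" "Ev a 0 = 0"
  by (simp_all add: Ev_def)

lemma spin_sub_daha: "p \<in> fcar (spin_gens n) \<Longrightarrow> p \<in> fcar (daha_gens n)"
  by (rule fcar_mono) (auto simp: daha_gens_def)

text \<open>Each clause of the graph is realised on \<open>1 \<otimes> V\<close>, where the
  \<xi>-generators act by zero. Two values at the same argument therefore have the same image under
  \<open>tn 1\<close> and coincide.\<close>

lemma xi_ext_graph_Ev:
  "xi_ext_graph n u act a v w \<Longrightarrow> a \<in> carrier (daha n u) \<and> Ev a (tn 1 v) = tn 1 w"
proof (induction rule: xi_ext_graph.induct)
  case (spin p v)
  then show ?case by (simp add: spin_sub_daha W_ev_tn_one V_ev)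
next
  case (xi i v)
  then show ?case using D_tn_const[of i 1 v] by simp
qed (auto simp: Ev_add Ev_mult tn_add_right)

lemma xi_ext_eq: "xi_ext_graph n u act a v w \<Longrightarrow> xi_ext n u act a v = w"
  unfolding xi_ext_def
proof (rule the_equality)
  fix w' assume "xi_ext_graph n u act a v w" "xi_ext_graph n u act a v w'"
  then show "w' = w" using xi_ext_graph_Ev[of a v w] xi_ext_graph_Ev[of a v w'] by (simp add: tn_one_inject)
qed

lemma h_xi_carrier: "h_xi n u \<subseteq> carrier (daha n u)"
  unfolding h_xi_def by (rule HR.generate_ring_incl) (auto simp: spin_sub_daha)

lemma xi_ext_graph_ex: "a \<in> h_xi n u \<Longrightarrow> \<exists>w. xi_ext_graph n u act a v w"
  unfolding h_xi_def
proof (induction arbitrary: v rule: generate_ring.induct)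
  case one
  show ?case using xi_ext_graph.spin[of 1 n u act v] H.cls_one by auto
next
  case (incl h)
  then consider p where "p \<in> fcar (spin_gens n)" "h = daha_cls n u p"
    | i where "i \<in> {1..n}" "h = daha_cls n u (xi_gen i)"
    by blast
  then show ?case by cases (simp, intro exI, erule xi_ext_graph.spin, simp, intro exI, rule xi_ext_graph.xi, simp)
next
  case (a_inv h)
  then have h: "h \<in> carrier (daha n u)" using h_xi_carrier by (auto simp: h_xi_def)
  \<comment> \<open>The graph has no clause for negatives; they are obtained as products with the
    spin element \<open>-1\<close>.\<close>
  have "daha_cls n u (- 1) \<oplus>\<^bsub>daha n u\<^esub> daha_cls n u 1 = \<zero>\<^bsub>daha n u\<^esub>"
    using ring_hom_zero[OF H.cls_hom ring_free_alg H.ring_A] H.cls_add[of "- 1" 1] by simp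
  then have "\<ominus>\<^bsub>daha n u\<^esub> \<one>\<^bsub>daha n u\<^esub> = daha_cls n u (- 1)"
    using HR.minus_equality[of "daha_cls n u (- 1)" "daha_cls n u 1"] by (simp add: H.cls_one)
  then have "\<ominus>\<^bsub>daha n u\<^esub> h = daha_cls n u (- 1) \<otimes>\<^bsub>daha n u\<^esub> h"
    using h HR.l_minus[of "\<one>\<^bsub>daha n u\<^esub>" h] by simp
  moreover obtain w where "xi_ext_graph n u act h v w" using a_inv.IH by blast
  ultimately show ?case
    using xi_ext_graph.mult[OF _ xi_ext_graph.spin[of "- 1" n u act w]] by auto
next
  case (eng_add a b)
  then obtain w w' where "xi_ext_graph n u act a v w" "xi_ext_graph n u act b v w'" by blast
  then show ?case by (intro exI) (rule xi_ext_graph.add)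
next
  case (eng_mult a b)
  then obtain w where w: "xi_ext_graph n u act b v w" by blast
  obtain w' where "xi_ext_graph n u act a w w'" using eng_mult.IH(1) by blast
  with w show ?case by (intro exI) (rule xi_ext_graph.mult)
qed

lemma Ev_h_xi: "a \<in> h_xi n u \<Longrightarrow> Ev a (tn 1 v) = tn 1 (xi_ext n u act a v)"
  using xi_ext_graph_ex[of a v] xi_ext_graph_Ev xi_ext_eq by blast

sublocale X: tensor_product "daha n u" "h_xi n u" "xi_ext n u act"
  by unfold_locales (rule h_xi_carrier)

subsection \<open>Evaluation of tensors\<close>

text \<open>The map \<open>a \<otimes> v \<mapsto> a (1 \<otimes> v)\<close> on representatives,
  with integer coefficients acting as complex scalars.\<close>

definition psi :: "((spin_gen falg set \<times> 'v) \<Rightarrow>\<^sub>0 int) \<Rightarrow> (nat \<Rightarrow>\<^sub>0 nat) \<Rightarrow>\<^sub>0 'v" where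
  "psi x = pm_sum (\<lambda>(a, v) z. ps (of_int z) (Ev a (tn 1 v))) x"

lemma additive_psi: "additive psi"
  by unfold_locales
    (auto simp: psi_def additive_def P.scale_left_distrib intro!: pm_sum_add)

lemmas psi_arith = additive.zero[OF additive_psi] additive.add[OF additive_psi]
  additive.minus[OF additive_psi] additive.diff[OF additive_psi] additive.sum[OF additive_psi]

lemma psi_frag_of [simp]: "psi (frag_of (a, v)) = Ev a (tn 1 v)"
  by (simp add: psi_def pm_sum_single)

lemma psi_null: "x \<in> X.N \<Longrightarrow> psi x = 0"
proof (induction rule: X.N_induct)
  case (rel x)
  then show ?case using h_xi_carrier
    unfolding tensor_rels_def by (auto simp: psi_arith Ev_add Ev_mult tn_add_right Ev_right Ev_h_xi)
qed (auto simp: psi_arith)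

lemma psi_smul:
  assumes h: "h \<in> carrier (daha n u)" and x: "Poly_Mapping.keys x \<subseteq> carrier (daha n u) \<times> UNIV"
  shows "psi (X.smul h x) = Ev h (psi x)"
  using x
proof (induction x rule: frag_induction)
  case zero
  show ?case by (simp add: psi_arith Ev_right)
next
  case (one y)
  then show ?case using h by (cases y) (auto simp: Ev_mult)
qed (simp add: X.smul_diff psi_arith Ev_right)

subsection \<open>The identification with polynomials\<close>

text \<open>The representative whose class is \<open>V_xi_ident n u act p\<close>. It is additive in
  \<open>p\<close> only modulo the tensor relations.\<close>

definition idf :: "((nat \<Rightarrow>\<^sub>0 nat) \<Rightarrow>\<^sub>0 'v) \<Rightarrow> (spin_gen falg set \<times> 'v) \<Rightarrow>\<^sub>0 int" where
  "idf p = (\<Sum>m\<in>Poly_Mapping.keys p. frag_of (daha_cls n u (y_monom n m), Poly_Mapping.lookup p m))"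

lemma V_xi_ident_idf: "V_xi_ident n u act p = tensor_cls (daha n u) (h_xi n u) (xi_ext n u act) (idf p)"
  by (simp add: V_xi_ident_def V_xi_cls_def idf_def)

lemma y_monom_fcar [simp]: "y_monom n m \<in> fcar (daha_gens n)"
  unfolding y_monom_def by (intro fcar_prod_list) auto

lemma keys_idf: "Poly_Mapping.keys (idf p) \<subseteq> carrier (daha n u) \<times> UNIV"
  using keys_sum[of "\<lambda>m. frag_of (daha_cls n u (y_monom n m), Poly_Mapping.lookup p m)" "Poly_Mapping.keys p"]
  by (auto simp: idf_def)

lemma W_ev_y_power: "W.ev (y_gen j ^ e) (tn f v) = tn (pvar j ^ e * f) v"
  by (induction e) (simp_all add: mult.assoc)

lemma W_ev_y_list: "W.ev (prod_list (map (\<lambda>j. y_gen j ^ e j) js)) (tn f v)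
    = tn (prod_list (map (\<lambda>j. pvar j ^ e j) js) * f) v"
  by (induction js) (simp_all add: W_ev_y_power mult.assoc)

lemma pvar_power: "pvar j ^ e = Poly_Mapping.single (Poly_Mapping.single j e) 1"
  by (induction e) (simp_all add: pvar_def mult_single flip: single_add)

lemma W_ev_y_monom:
  assumes "Poly_Mapping.keys m \<subseteq> {1..n}"
  shows "W.ev (y_monom n m) (tn 1 v) = Poly_Mapping.single m v"
proof -
  let ?e = "\<lambda>j. Poly_Mapping.single j (Poly_Mapping.lookup m j)"
  have "prod_list (map (\<lambda>j. pvar j ^ Poly_Mapping.lookup m j) js)
      = Poly_Mapping.single (sum_list (map ?e js)) 1" for js
    by (induction js) (simp_all add: pvar_power mult_single)
  moreover have "sum_list (map ?e [1..<n + 1]) = (\<Sum>j\<in>{1..n}. ?e j)"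
    by (simp add: sum_list_distinct_conv_sum_set atLeastLessThanSuc_atLeastAtMost del: upt_Suc)
  moreover have "(\<Sum>j\<in>{1..n}. ?e j) = (\<Sum>j\<in>Poly_Mapping.keys m. ?e j)"
    using assms by (intro sum.mono_neutral_right) (auto simp: in_keys_iff)
  ultimately show ?thesis
    unfolding y_monom_def W_ev_y_list by (simp add: poly_mapping_sum_singles tn_single)
qed

lemma psi_idf:
  assumes "p \<in> polys n"
  shows "psi (idf p) = p"
proof -
  have "psi (idf p) = (\<Sum>m\<in>Poly_Mapping.keys p. Poly_Mapping.single m (Poly_Mapping.lookup p m))"
    unfolding idf_def psi_arith
    using assms by (intro sum.cong) (auto simp: polys_def W_ev_y_monom)
  then show ?thesis by (simp add: poly_mapping_sum_singles)
qed

text \<open>\<open>psi\<close> depends only on the tensor class and recovers \<open>p\<close> from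
  \<open>idf p\<close>.\<close>

lemma inj_on_ident: "inj_on (V_xi_ident n u act) (polys n)"
proof (rule inj_onI)
  fix p q :: "(nat \<Rightarrow>\<^sub>0 nat) \<Rightarrow>\<^sub>0 'v"
  assume pq: "p \<in> polys n" "q \<in> polys n" and "V_xi_ident n u act p = V_xi_ident n u act q"
  then have "psi (idf p - idf q) = 0"
    by (intro psi_null) (simp add: V_xi_ident_idf X.tensor_cls_iff)
  then show "p = q" using pq by (simp add: psi_arith psi_idf)
qed

text \<open>The union of the classes in the image of \<open>V_xi_ident\<close>, which allows work
  with representatives throughout.\<close>

definition img :: "((spin_gen falg set \<times> 'v) \<Rightarrow>\<^sub>0 int) set" where
  "img = {x. \<exists>q\<in>polys n. x - idf q \<in> X.N}"

lemma img_cong: "x - y \<in> X.N \<Longrightarrow> y \<in> img \<Longrightarrow> x \<in> img"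
  using X.N_add[of "x - y" "y - idf q" for q] by (auto simp: img_def)

text \<open>Additional indices contribute symbols with vector 0, which are null. Polynomials of
  different support can thus be compared over a common index set.\<close>

lemma idf_superset:
  assumes "finite K" "Poly_Mapping.keys p \<subseteq> K"
  shows "(\<Sum>m\<in>K. frag_of (daha_cls n u (y_monom n m), Poly_Mapping.lookup p m)) - idf p \<in> X.N"
  unfolding idf_def sum_diff[OF assms, symmetric]
  by (intro X.N_sum) (auto simp: in_keys_iff intro: X.N_zero_right)

lemma img_zero: "0 \<in> img"
  unfolding img_def by (rule CollectI, rule bexI[of _ 0]) (simp_all add: polys_def idf_def)

lemma img_add:
  assumes "x \<in> img" "y \<in> img"
  shows "x + y \<in> img"
proof -
  obtain p q where p: "p \<in> polys n" "x - idf p \<in> X.N" and q: "q \<in> polys n" "y - idf q \<in> X.N"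
    using assms by (auto simp: img_def)
  let ?K = "Poly_Mapping.keys p \<union> Poly_Mapping.keys q"
  let ?A = "\<lambda>r. \<Sum>m\<in>?K. frag_of (daha_cls n u (y_monom n m), Poly_Mapping.lookup r m)"
  have A: "?A (p + q) - ?A p - ?A q \<in> X.N"
    unfolding sum_subtractf[symmetric] lookup_add by (intro X.N_sum X.N_add_right) simp
  have B: "?A p - idf p \<in> X.N" "?A q - idf q \<in> X.N" "?A (p + q) - idf (p + q) \<in> X.N"
    using keys_add[of p q] by (intro idf_superset; auto)+
  have "(x - idf p) + (y - idf q) - (?A p - idf p) - (?A q - idf q)
      + (?A (p + q) - idf (p + q)) - (?A (p + q) - ?A p - ?A q) \<in> X.N"
    by (intro X.N_add X.N_diff A B p q)
  then have "(x + y) - idf (p + q) \<in> X.N" by (simp add: algebra_simps)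
  moreover have "p + q \<in> polys n" using p q keys_add[of p q] by (auto simp: polys_def)
  ultimately show ?thesis by (auto simp: img_def)
qed

lemma img_sum: "(\<And>k. k \<in> K \<Longrightarrow> f k \<in> img) \<Longrightarrow> sum f K \<in> img"
  by (induction K rule: infinite_finite_induct) (auto intro: img_add img_zero)

lemma img_monom:
  assumes "Poly_Mapping.keys m \<subseteq> {1..n}"
  shows "frag_of (daha_cls n u (y_monom n m), v) \<in> img"
proof (cases "v = 0")
  case True
  then show ?thesis using img_cong[OF _ img_zero] by (simp add: X.N_zero_right)
next
  case False
  then have "Poly_Mapping.single m v \<in> polys n"
    "frag_of (daha_cls n u (y_monom n m), v) = idf (Poly_Mapping.single m v)"
    using assms by (simp_all add: polys_def idf_def)
  then show ?thesis unfolding img_def by (auto intro!: bexI[of _ "Poly_Mapping.single m v"])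
qed

text \<open>
  \<open>good\<close> collects the \<open>a\<close> for which all \<open>a \<otimes> v\<close> lie in the image of the identification, \<open>stab\<close> the
  elements whose left multiplication preserves that image.
\<close>

definition good :: "spin_gen falg set" where
  "good = {a \<in> fcar (daha_gens n). \<forall>v. frag_of (daha_cls n u a, v) \<in> img}"

definition stab :: "spin_gen falg set" where
  "stab = {h \<in> fcar (daha_gens n). \<forall>a\<in>good. h * a \<in> good}"

text \<open>Congruence modulo the relations of the Hecke algebra, so that rewriting takes place on
  words in the free algebra.\<close>

definition heq :: "spin_gen falg \<Rightarrow> spin_gen falg \<Rightarrow> bool" (infix \<open>\<doteq>\<close> 50) where
  "p \<doteq> q \<longleftrightarrow> p \<in> fcar (daha_gens n) \<and> q \<in> fcar (daha_gens n) \<and> daha_cls n u p = daha_cls n u q"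

lemma heq_refl: "p \<in> fcar (daha_gens n) \<Longrightarrow> p \<doteq> p"
  by (simp add: heq_def)

lemma heq_sym: "p \<doteq> q \<Longrightarrow> q \<doteq> p"
  by (simp add: heq_def)

lemma heq_trans [trans]: "p \<doteq> q \<Longrightarrow> q \<doteq> r \<Longrightarrow> p \<doteq> r"
  by (simp add: heq_def)

lemma heq_mult: "p \<doteq> p' \<Longrightarrow> q \<doteq> q' \<Longrightarrow> p * q \<doteq> p' * q'"
  by (simp add: heq_def H.cls_mult)

lemma heq_rel: "p - q \<in> daha_rels n u \<Longrightarrow> p \<in> fcar (daha_gens n) \<Longrightarrow> q \<in> fcar (daha_gens n) \<Longrightarrow> p \<doteq> q"
  by (simp add: heq_def H.cls_eqI)

lemma good_fcar: "a \<in> good \<Longrightarrow> a \<in> fcar (daha_gens n)"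
  by (simp add: good_def)

lemma stab_fcar: "h \<in> stab \<Longrightarrow> h \<in> fcar (daha_gens n)"
  by (simp add: stab_def)

lemma good_cong: "a \<doteq> b \<Longrightarrow> b \<in> good \<Longrightarrow> a \<in> good"
  by (simp add: good_def heq_def)

lemma good_add:
  assumes "a \<in> good" "b \<in> good"
  shows "a + b \<in> good"
proof -
  have "frag_of (daha_cls n u (a + b), v) \<in> img" for v
  proof (rule img_cong)
    show "frag_of (daha_cls n u a, v) + frag_of (daha_cls n u b, v) \<in> img"
      using assms by (auto simp: good_def intro: img_add)
    show "frag_of (daha_cls n u (a + b), v) - (frag_of (daha_cls n u a, v) + frag_of (daha_cls n u b, v)) \<in> X.N"
      using assms X.N_add_left[of "daha_cls n u a" "daha_cls n u b" v]
      by (simp add: good_def H.cls_add algebra_simps)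
  qed
  then show ?thesis using assms by (simp add: good_def)
qed

text \<open>A spin element on the right moves across the tensor sign and only changes the
  vector.\<close>

lemma good_spin:
  assumes "a \<in> good" "p \<in> fcar (spin_gens n)"
  shows "a * p \<in> good"
proof -
  have "xi_ext n u act (daha_cls n u p) v = act (spin_cls n p) v" for v
    by (rule xi_ext_eq, rule xi_ext_graph.spin) fact
  moreover have "daha_cls n u p \<in> h_xi n u"
    unfolding h_xi_def using assms by (intro generate_ring.incl) auto
  ultimately have "frag_of (daha_cls n u (a * p), v) \<in> img" for v
    using X.N_balanced[of "daha_cls n u a" "daha_cls n u p" v] assms
      img_cong[of _ "frag_of (daha_cls n u a, act (spin_cls n p) v)"]
    by (simp add: good_def H.cls_mult spin_sub_daha)
  then show ?thesis using assms by (simp add: good_def spin_sub_daha)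
qed

text \<open>By balancing, \<open>\<xi>_i \<otimes> v\<close> equals \<open>1 \<otimes> 0\<close>,
  which is null.\<close>

lemma xi_good:
  assumes "i \<in> {1..n}"
  shows "xi_gen i \<in> good"
proof -
  have "xi_ext n u act (daha_cls n u (xi_gen i)) v = 0" for v
    by (rule xi_ext_eq, rule xi_ext_graph.xi) fact
  moreover have "daha_cls n u (xi_gen i) \<in> h_xi n u"
    unfolding h_xi_def using assms by (intro generate_ring.incl) auto
  ultimately have "frag_of (daha_cls n u (xi_gen i), v) \<in> img" for v
    using X.N_balanced[of "daha_cls n u 1" "daha_cls n u (xi_gen i)" v] assms
      X.N_add[OF _ X.N_zero_right[of "daha_cls n u 1"]] img_cong[OF _ img_zero]
    by (fastforce simp flip: H.cls_mult)
  then show ?thesis using assms by (simp add: good_def)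
qed

lemma monom_good: "Poly_Mapping.keys m \<subseteq> {1..n} \<Longrightarrow> y_monom n m \<in> good"
  by (simp add: good_def img_monom)

lemma y_monom_zero: "y_monom n 0 = 1"
proof -
  have "prod_list (map (\<lambda>j. 1) js) = (1 :: spin_gen falg)" for js :: "nat list"
    by (induction js) auto
  then show ?thesis by (simp add: y_monom_def del: upt_Suc)
qed

lemma one_good: "1 \<in> good"
  using monom_good[of 0] by (simp add: y_monom_zero)

text \<open>For good \<open>a\<close>, the tensor \<open>a \<otimes> v\<close> is congruent to a sum
  of terms \<open>y^m \<otimes> w\<close>; after left multiplication by \<open>h\<close> only the
  products of \<open>h\<close> with monomials matter.\<close>

lemma stabI:
  assumes h: "h \<in> fcar (daha_gens n)"
    and m: "\<And>m. Poly_Mapping.keys m \<subseteq> {1..n} \<Longrightarrow> h * y_monom n m \<in> good"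
  shows "h \<in> stab"
proof -
  have "frag_of (daha_cls n u (h * a), v) \<in> img" if a: "a \<in> good" for a v
  proof -
    obtain q where q: "q \<in> polys n" "frag_of (daha_cls n u a, v) - idf q \<in> X.N"
      using a by (auto simp: good_def img_def)
    have "X.smul (daha_cls n u h) (frag_of (daha_cls n u a, v) - idf q) \<in> X.N"
      by (rule X.smul_N) (use h q in auto)
    then have "frag_of (daha_cls n u (h * a), v) - X.smul (daha_cls n u h) (idf q) \<in> X.N"
      using h a by (simp add: X.smul_diff H.cls_mult good_def)
    moreover have "X.smul (daha_cls n u h) (idf q) \<in> img"
      unfolding idf_def X.smul_sum using q(1) m h
      by (intro img_sum) (auto simp: polys_def good_def H.cls_mult)
    ultimately show ?thesis by (rule img_cong)
  qed
  with h show ?thesis by (auto simp: stab_def good_def)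
qed

lemma stab_mult: "g \<in> stab \<Longrightarrow> h \<in> stab \<Longrightarrow> g * h \<in> stab"
  by (auto simp: stab_def mult.assoc)

lemma stab_add: "g \<in> stab \<Longrightarrow> h \<in> stab \<Longrightarrow> g + h \<in> stab"
  by (auto simp: stab_def distrib_right good_add)

lemma stab_const: "const c \<in> stab"
  by (rule stabI) (auto simp: const_commute[of c] intro!: good_spin monom_good)

lemma stab_good: "h \<in> stab \<Longrightarrow> a \<in> good \<Longrightarrow> h * a \<in> good"
  by (simp add: stab_def)

section \<open>Stability of the image under the generators\<close>

lemma y_comm: "i \<in> {1..n} \<Longrightarrow> j \<in> {1..n} \<Longrightarrow> y_gen i * y_gen j \<doteq> y_gen j * y_gen i"
  by (rule heq_rel) (auto simp: daha_rels_def)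

lemma y_power_comm:
  assumes "i \<in> {1..n}" "j \<in> {1..n}"
  shows "y_gen j * y_gen i ^ e \<doteq> y_gen i ^ e * y_gen j"
proof (induction e)
  case 0
  show ?case using assms by (simp add: heq_refl)
next
  case (Suc e)
  have 1: "(y_gen j * y_gen i) * y_gen i ^ e \<doteq> (y_gen i * y_gen j) * y_gen i ^ e"
    using assms by (intro heq_mult y_comm heq_refl) auto
  have 2: "y_gen i * (y_gen j * y_gen i ^ e) \<doteq> y_gen i * (y_gen i ^ e * y_gen j)"
    using assms by (intro heq_mult Suc heq_refl) auto
  show ?case using heq_trans[OF 1[unfolded mult.assoc] 2] by (simp add: mult.assoc)
qed

lemma y_times_list:
  assumes "distinct js" "j \<in> set js" "set js \<subseteq> {1..n}"
  shows "y_gen j * prod_list (map (\<lambda>i. y_gen i ^ e i) js)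
    \<doteq> prod_list (map (\<lambda>i. y_gen i ^ (if i = j then Suc (e i) else e i)) js)"
  using assms
proof (induction js)
  case (Cons i js)
  let ?P = "\<lambda>js. prod_list (map (\<lambda>i. y_gen i ^ e i) js)"
  let ?P' = "\<lambda>js. prod_list (map (\<lambda>i. y_gen i ^ (if i = j then Suc (e i) else e i)) js)"
  have gens: "y_gen i \<in> fcar (daha_gens n)" if "i \<in> set js" for i
    using Cons.prems that by (simp del: atLeastAtMost_iff) blast
  have car: "?P js \<in> fcar (daha_gens n)" "?P' js \<in> fcar (daha_gens n)"
    using gens by (auto intro!: fcar_prod_list)
  show ?case
  proof (cases "i = j")
    case True
    then have "map (\<lambda>i. y_gen i ^ (if i = j then Suc (e i) else e i)) js = map (\<lambda>i. y_gen i ^ e i) js"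
      using Cons.prems by (intro map_cong) auto
    then have eq: "?P' js = ?P js" by (rule arg_cong)
    show ?thesis
      unfolding list.map prod_list.Cons eq
      using True car(1) Cons.prems by (auto simp: mult.assoc intro!: heq_refl)
  next
    case False
    have 1: "(y_gen j * y_gen i ^ e i) * ?P js \<doteq> (y_gen i ^ e i * y_gen j) * ?P js"
      using Cons.prems car by (intro heq_mult y_power_comm heq_refl) auto
    have 2: "y_gen i ^ e i * (y_gen j * ?P js) \<doteq> y_gen i ^ e i * ?P' js"
      using False Cons by (intro heq_mult Cons.IH heq_refl) auto
    show ?thesis using heq_trans[OF 1[unfolded mult.assoc] 2] False by (simp add: mult.assoc)
  qed
qed simp

lemma y_times_monom:
  assumes "j \<in> {1..n}"
  shows "y_gen j * y_monom n m \<doteq> y_monom n (Poly_Mapping.single j 1 + m)"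
proof -
  have "(\<lambda>i. y_gen i ^ Poly_Mapping.lookup (Poly_Mapping.single j 1 + m) i)
    = (\<lambda>i. y_gen i ^ (if i = j then Suc (Poly_Mapping.lookup m i) else Poly_Mapping.lookup m i))"
    by (auto simp: lookup_add lookup_single when_def)
  then show ?thesis
    unfolding y_monom_def using assms by (auto simp del: upt_Suc intro!: y_times_list)
qed

lemma keys_single_add:
  "j \<in> J \<Longrightarrow> Poly_Mapping.keys m \<subseteq> J \<Longrightarrow> Poly_Mapping.keys (Poly_Mapping.single j (1::nat) + m) \<subseteq> J"
  using keys_add[of "Poly_Mapping.single j (1::nat)" m] by auto

lemma stab_y:
  assumes j: "j \<in> {1..n}"
  shows "y_gen j \<in> stab"
proof (rule stabI)
  show "y_gen j \<in> fcar (daha_gens n)" using j by simp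
next
  fix m :: "nat \<Rightarrow>\<^sub>0 nat" assume m: "Poly_Mapping.keys m \<subseteq> {1..n}"
  show "y_gen j * y_monom n m \<in> good"
    by (rule good_cong[OF y_times_monom[OF j] monom_good[OF keys_single_add[OF j m]]])
qed

text \<open>Induction on monomials, one variable at a time: it remains to move \<open>h\<close> past
  a single \<open>y_j\<close>.\<close>

lemma stab_by_degree:
  assumes h: "h \<in> fcar (daha_gens n)" "h \<in> good"
    and step: "\<And>j a. j \<in> {1..n} \<Longrightarrow> a \<in> good \<Longrightarrow> h * a \<in> good \<Longrightarrow> h * (y_gen j * a) \<in> good"
  shows "h \<in> stab"
proof (rule stabI[OF h(1)])
  fix m :: "nat \<Rightarrow>\<^sub>0 nat" assume "Poly_Mapping.keys m \<subseteq> {1..n}"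
  then show "h * y_monom n m \<in> good"
  proof (induction m rule: monomial_induct)
    case zero
    show ?case using h by (simp add: y_monom_zero)
  next
    case (var m j)
    have "h * y_monom n (Poly_Mapping.single j 1 + m) \<doteq> h * (y_gen j * y_monom n m)"
      by (rule heq_mult[OF heq_refl[OF h(1)] heq_sym[OF y_times_monom[OF var(2)]]])
    then show ?case
      by (rule good_cong) (rule step[OF var(2) monom_good[OF var(1)] var(3)])
  qed
qed

text \<open>For \<open>j = a + 1\<close> the identity is not itself a defining relation; it results
  from \<open>t_a y_a = y_(a+1) t_a\<close> by multiplying with the involution \<open>t_a\<close> on
  both sides.\<close>

lemma t_y:
  assumes a: "a \<in> {1..<n}" and j: "j \<in> {1..n}"
  shows "t_gen a * y_gen j \<doteq> y_gen (transpose a (Suc a) j) * t_gen a"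
proof -
  have "t_gen a * y_gen a - y_gen (a + 1) * t_gen a \<in> daha_rels n u"
    unfolding daha_rels_def using a by blast
  then have ya: "t_gen a * y_gen a \<doteq> y_gen (Suc a) * t_gen a"
    using a by (intro heq_rel) simp_all
  have "t_gen a * t_gen a - 1 \<in> daha_rels n u"
    unfolding daha_rels_def spin_rels_def using a by blast
  then have tt: "t_gen a * t_gen a \<doteq> 1"
    using a by (intro heq_rel) simp_all
  consider "j = a" | "j = Suc a" | "j \<noteq> a" "j \<noteq> Suc a" by blast
  then show ?thesis
  proof cases
    case 1
    then show ?thesis using ya by simp
  next
    case 2
    have "t_gen a * y_gen (Suc a) \<doteq> t_gen a * y_gen (Suc a) * (t_gen a * t_gen a)"
      using heq_mult[OF heq_refl heq_sym[OF tt], of "t_gen a * y_gen (Suc a)"] a by simp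
    also have "\<dots> = t_gen a * (y_gen (Suc a) * t_gen a) * t_gen a"
      by (simp add: mult.assoc)
    also have "\<dots> \<doteq> t_gen a * (t_gen a * y_gen a) * t_gen a"
      using a by (intro heq_mult heq_refl heq_sym[OF ya]) auto
    also have "\<dots> = t_gen a * t_gen a * (y_gen a * t_gen a)"
      by (simp add: mult.assoc)
    also have "\<dots> \<doteq> 1 * (y_gen a * t_gen a)"
      using a by (intro heq_mult heq_refl tt) auto
    finally show ?thesis using 2 by simp
  next
    case 3
    then have j': "j \<noteq> a + 1" and "transpose a (Suc a) j = j" by (simp_all add: transpose_def)
    have "t_gen a * y_gen j - y_gen j * t_gen a \<in> daha_rels n u"
      unfolding daha_rels_def using a j 3 j' by blast
    with \<open>transpose a (Suc a) j = j\<close> show ?thesis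
      using a j heq_rel[of "t_gen a * y_gen j" "y_gen j * t_gen a"] by simp
  qed
qed

lemma stab_t:
  assumes a: "a \<in> {1..<n}"
  shows "t_gen a \<in> stab"
proof (rule stab_by_degree)
  show "t_gen a \<in> fcar (daha_gens n)" using a by simp
  show "t_gen a \<in> good" using good_spin[OF one_good, of "t_gen a"] a by simp
next
  fix j b assume j: "j \<in> {1..n}" and b: "b \<in> good" "t_gen a * b \<in> good"
  have 1: "(t_gen a * y_gen j) * b \<doteq> (y_gen (transpose a (Suc a) j) * t_gen a) * b"
    using a j b by (intro heq_mult t_y heq_refl) (auto simp: good_fcar)
  show "t_gen a * (y_gen j * b) \<in> good"
    by (rule good_cong[OF 1[unfolded mult.assoc]], rule stab_good[OF stab_y b(2)])
      (use a j in \<open>auto simp: transpose_def\<close>)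
qed

lemma stab_spin: "p \<in> fcar (spin_gens n) \<Longrightarrow> p \<in> stab"
proof (induction p rule: free_alg_induct)
  case zero
  show ?case using stab_const[of 0] by (simp add: const_def)
next
  case (gen g)
  then show ?case by (auto simp: spin_gens_def intro: stab_t)
qed (rule stab_const stab_add stab_mult; assumption)+

lemma stab_xi:
  assumes i: "i \<in> {1..n}"
  shows "xi_gen i \<in> stab"
proof (rule stab_by_degree)
  show "xi_gen i \<in> fcar (daha_gens n)" using i by simp
  show "xi_gen i \<in> good" by (rule xi_good[OF i])
next
  fix j b assume j: "j \<in> {1..n}" and b: "b \<in> good" "xi_gen i * b \<in> good"
  \<comment> \<open>The correction in \<open>\<xi>_i y_j = y_j \<xi>_i + r\<close>. It lies in the
    spin subalgebra, whose stability is already known.\<close>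
  define r where "r = (if i = j then - (const u * (\<Sum>k\<in>{1..n} - {i}. br i k)) else const u * br i j)"
  have r: "r \<in> stab"
    unfolding r_def using i j
    by (auto intro!: stab_spin fcar_mult fcar_sum fcar_br)
  have "y_gen j * xi_gen i - xi_gen i * y_gen j + r \<in> daha_rels n u"
  proof (cases "i = j")
    case True
    have "y_gen i * xi_gen i - xi_gen i * y_gen i - const u * (\<Sum>k\<in>{1..n} - {i}. br i k) \<in> daha_rels n u"
      unfolding daha_rels_def using i by blast
    with True show ?thesis by (simp add: r_def)
  next
    case False
    then have "y_gen j * xi_gen i - xi_gen i * y_gen j + const u * br i j \<in> daha_rels n u"
      unfolding daha_rels_def using i j by blast
    with False show ?thesis by (simp add: r_def)
  qed
  then have "y_gen j * xi_gen i + r - xi_gen i * y_gen j \<in> daha_rels n u"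
    by (simp only: diff_add_eq)
  then have "y_gen j * xi_gen i + r \<doteq> xi_gen i * y_gen j"
    using i j r by (intro heq_rel) (auto simp: stab_fcar)
  then have 1: "(xi_gen i * y_gen j) * b \<doteq> (y_gen j * xi_gen i + r) * b"
    using b by (intro heq_mult heq_refl) (auto intro: heq_sym good_fcar)
  show "xi_gen i * (y_gen j * b) \<in> good"
    by (rule good_cong[OF 1[unfolded mult.assoc distrib_right]]) (intro good_add stab_good stab_y j b r)
qed

text \<open>Stability of the image provides some \<open>q\<close> representing the transported
  value; \<open>psi\<close>, which is compatible with the actions and inverts \<open>idf\<close>,
  identifies \<open>q\<close> as \<open>D i p\<close>.\<close>

lemma xi_act:
  assumes i: "i \<in> {1..n}" and p: "p \<in> polys n"
  shows "poly_act n u act (daha_cls n u (xi_gen i)) p = D i p"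
proof -
  let ?x = "X.smul (daha_cls n u (xi_gen i)) (idf p)"
  have "?x \<in> img"
    unfolding idf_def X.smul_sum using p i stab_good[OF stab_xi[OF i] monom_good]
    by (intro img_sum) (auto simp: polys_def good_def H.cls_mult)
  then obtain q where q: "q \<in> polys n" "?x - idf q \<in> X.N"
    by (auto simp: img_def)
  have "V_xi_act n u act (daha_cls n u (xi_gen i)) (V_xi_ident n u act p) = V_xi_ident n u act q"
    using q i by (simp add: V_xi_act_def V_xi_ident_idf X.tensor_act_cls X.tensor_cls_iff)
  then have "poly_act n u act (daha_cls n u (xi_gen i)) p = q"
    using q by (simp add: poly_act_def the_inv_into_f_f[OF inj_on_ident])
  also have "q = psi ?x"
    using psi_null[OF q(2)] q(1) by (simp add: psi_arith psi_idf)
  also have "\<dots> = D i p"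
    using i p by (simp add: psi_smul[OF _ keys_idf] psi_idf)
  finally show ?thesis .
qed

end

theorem proposition6p2:
  fixes n i :: nat and u :: complex
    and act :: "spin_gen falg set \<Rightarrow> 'v::ab_group_add \<Rightarrow> 'v"
    and f :: "(nat \<Rightarrow>\<^sub>0 nat) \<Rightarrow>\<^sub>0 complex" and v :: 'v
  assumes "left_module (spin_alg n) act"
    and "i \<in> {1..n}"
    and "f \<in> polys n"
  shows "poly_act n u act (daha_cls n u (xi_gen i)) (ptensor n act f v) =
    pscale n act u
      (\<Sum>k\<in>{1..n} - {i}.
        ptensor n act (exact_quot (f - perm_poly (transpose k i) f) (pvar i - pvar k))
          (act (spin_cls n (br k i)) v))"
proof -
  interpret induced_module n u act by (rule induced_module.intro) (rule assms(1))
  have "tn f v \<in> polys n"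
    using assms(3) by (auto simp: polys_def in_keys_iff)
  then have "poly_act n u act (daha_cls n u (xi_gen i)) (tn f v) = D i (tn f v)"
    by (rule xi_act[OF assms(2)])
  \<comment> \<open>The brackets involve spin generators only, so by \<open>V_ev\<close> their
    evaluation agrees with the given module action.\<close>
  also have "\<dots> = ps u (\<Sum>k\<in>{1..n} - {i}. tn (div_diff i k f) (act (spin_cls n (br k i)) v))"
    unfolding D_tn using assms(2)
    by (intro arg_cong[where f = "ps u"] sum.cong) (auto simp: V_ev fcar_br)
  finally show ?thesis
    by (simp only: tn_def ps_def div_diff_def ptensor_def pscale_def)
qed

end
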